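(* Let $\mathscr{K}$ be an essentially small monoidal-triangulated category. Suppose $\mathscr{K}$ satisfies the weak central generation hypothesis with centralizing set $I\subseteq\mathrm{Ob}(\mathscr{K})$ and has compact detection (for example, $\mathscr{K}$ is rigid). Then every principal thick $\otimes$-ideal of $\mathscr{K}$ is generated by an element centralizing $I$. Consequently, $\mathscr{K}$ is principally closed.
   Context: A monoidal-triangulated category is a triangulated category $\mathscr{K}$ with a monoidal structure $(\otimes,\mathbb{1})$, not assumed symmetric or braided, such that $\otimes$ is exact in each variable. A thick subcategory is a full triangulated subcategory closed under direct summands; a thick $\otimes$-ideal is a thick subcategory $\mathscr{I}$ with $x\otimes y,\ y\otimes x\in\mathscr{I}$ for all $x\in\mathscr{I}$, $y\in\mathscr{K}$. A thick $\otimes$-ideal is principal if it is generated by a single object. A proper thick $\otimes$-ideal $\mathscr{P}$ is prime if for all thick $\otimes$-ideals $\mathscr{I},\mathscr{J}$, $\mathscr{I}\otimes\mathscr{J}\subseteq\mathscr{P}$ implies $\mathscr{I}\subseteq\mathscr{P}$ or $\mathscr{J}\subseteq\mathscr{P}$. A thick $\otimes$-ideal is semiprime if it is an intersection of primes ($\mathscr{K}$ being the empty intersection); $\langle x\rangle_s$ is the smallest semiprime thick $\otimes$-ideal containing $x$. An object $x$ centralizes $I$ if $x\otimes y\cong y\otimes x$ (possibly non-functorially) for all $y\in I$. $\mathscr{K}$ satisfies the weak central generation hypothesis with centralizing set $I$ if $I$ is a collection of objects generating $\mathscr{K}$ as a thick subcategory and every thick $\otimes$-ideal of $\mathscr{K}$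 is generated by a collection of objects centralizing $I$. (The central generation hypothesis is the case $I=\mathrm{Ob}(\mathscr{K})$.) Compact detection: for all $x\in\mathscr{K}$ there is $s_x\in\mathscr{K}$ such that for every semiprime thick $\otimes$-ideal $\mathscr{I}$: $x\in\mathscr{I}$ if and only if $x\otimes s_x\otimes x\in\mathscr{I}$. Principally closed: for all $x,y\in\mathscr{K}$ there is $z\in\mathscr{K}$ with $\langle x\rangle_s\cap\langle y\rangle_s=\langle z\rangle_s$. *)

theory Defs
  imports "HOL-Algebra.Group"
begin

section \<open>Categories and functors\<close>

text \<open>
  Objects and arrows form sets, so the categories below are small. Nothing constrains the
  record fields outside of \<open>ob\<close>, \<open>arr\<close> and composable pairs.
\<close>

record ('o, 'm) cat =
  ob  :: "'o set"
  arr :: "'m set"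
  src :: "'m \<Rightarrow> 'o"
  tgt :: "'m \<Rightarrow> 'o"
  idn :: "'o \<Rightarrow> 'm"
  cmp :: "'m \<Rightarrow> 'm \<Rightarrow> 'm"  (infixl "\<cdot>\<index>" 70)

definition Hom :: "('o, 'm, 'z) cat_scheme \<Rightarrow> 'o \<Rightarrow> 'o \<Rightarrow> 'm set" where
  "Hom C x y = {f \<in> arr C. src C f = x \<and> tgt C f = y}"

locale category =
  fixes C :: "('o, 'm, 'z) cat_scheme" (structure)
  assumes src_ob: "f \<in> arr C \<Longrightarrow> src C f \<in> ob C"
    and tgt_ob: "f \<in> arr C \<Longrightarrow> tgt C f \<in> ob C"
    and idn_Hom: "x \<in> ob C \<Longrightarrow> idn C x \<in> Hom C x x"
    and cmp_Hom: "\<lbrakk>f \<in> Hom C x y; g \<in> Hom C y z\<rbrakk> \<Longrightarrow> g \<cdot> f \<in> Hom C x z"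
    and cmp_idn: "f \<in> Hom C x y \<Longrightarrow> f \<cdot> idn C x = f"
    and idn_cmp: "f \<in> Hom C x y \<Longrightarrow> idn C y \<cdot> f = f"
    and cmp_assoc: "\<lbrakk>f \<in> Hom C w x; g \<in> Hom C x y; h \<in> Hom C y z\<rbrakk>
          \<Longrightarrow> (h \<cdot> g) \<cdot> f = h \<cdot> (g \<cdot> f)"

definition inverse_arrs :: "('o, 'm, 'z) cat_scheme \<Rightarrow> 'm \<Rightarrow> 'm \<Rightarrow> bool" where
  "inverse_arrs C f g \<longleftrightarrow> f \<in> arr C \<and> g \<in> Hom C (tgt C f) (src C f)
     \<and> g \<cdot>\<^bsub>C\<^esub> f = idn C (src C f) \<and> f \<cdot>\<^bsub>C\<^esub> g = idn C (tgt C f)"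

definition iso_arr :: "('o, 'm, 'z) cat_scheme \<Rightarrow> 'm \<Rightarrow> bool" where
  "iso_arr C f \<longleftrightarrow> (\<exists>g. inverse_arrs C f g)"

definition inv_arr :: "('o, 'm, 'z) cat_scheme \<Rightarrow> 'm \<Rightarrow> 'm" where
  "inv_arr C f = (THE g. inverse_arrs C f g)"

definition isomorphic :: "('o, 'm, 'z) cat_scheme \<Rightarrow> 'o \<Rightarrow> 'o \<Rightarrow> bool" where
  "isomorphic C x y \<longleftrightarrow> (\<exists>f \<in> Hom C x y. iso_arr C f)"

definition zero_object :: "('o, 'm, 'z) cat_scheme \<Rightarrow> 'o \<Rightarrow> bool" where
  "zero_object C z \<longleftrightarrow>
     z \<in> ob C \<and> (\<forall>x \<in> ob C. (\<exists>!f. f \<in> Hom C z x) \<and> (\<exists>!f. f \<in> Hom C x z))"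

definition is_functor ::
  "('o, 'm, 'z) cat_scheme \<Rightarrow> ('p, 'n, 'w) cat_scheme \<Rightarrow> ('o \<Rightarrow> 'p) \<Rightarrow> ('m \<Rightarrow> 'n) \<Rightarrow> bool" where
  "is_functor C D Fo Fa \<longleftrightarrow>
     (\<forall>x \<in> ob C. Fo x \<in> ob D \<and> Fa (idn C x) = idn D (Fo x)) \<and>
     (\<forall>f \<in> arr C. Fa f \<in> Hom D (Fo (src C f)) (Fo (tgt C f))) \<and>
     (\<forall>f \<in> arr C. \<forall>g \<in> arr C. tgt C f = src C g \<longrightarrow> Fa (g \<cdot>\<^bsub>C\<^esub> f) = Fa g \<cdot>\<^bsub>D\<^esub> Fa f)"

definition natural_iso ::
  "('o, 'm, 'z) cat_scheme \<Rightarrow> ('p, 'n, 'w) cat_scheme \<Rightarrow> ('o \<Rightarrow> 'p) \<Rightarrow> ('m \<Rightarrow> 'n)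
     \<Rightarrow> ('o \<Rightarrow> 'p) \<Rightarrow> ('m \<Rightarrow> 'n) \<Rightarrow> ('o \<Rightarrow> 'n) \<Rightarrow> bool" where
  "natural_iso C D Fo Fa Go Ga \<phi> \<longleftrightarrow>
     (\<forall>x \<in> ob C. \<phi> x \<in> Hom D (Fo x) (Go x) \<and> iso_arr D (\<phi> x)) \<and>
     (\<forall>f \<in> arr C. Ga f \<cdot>\<^bsub>D\<^esub> \<phi> (src C f) = \<phi> (tgt C f) \<cdot>\<^bsub>D\<^esub> Fa f)"

definition equivalence ::
  "('o, 'm, 'z) cat_scheme \<Rightarrow> ('p, 'n, 'w) cat_scheme \<Rightarrow> ('o \<Rightarrow> 'p) \<Rightarrow> ('m \<Rightarrow> 'n) \<Rightarrow> bool" where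
  "equivalence C D Fo Fa \<longleftrightarrow> is_functor C D Fo Fa \<and>
     (\<forall>x \<in> ob C. \<forall>y \<in> ob C. bij_betw Fa (Hom C x y) (Hom D (Fo x) (Fo y))) \<and>
     (\<forall>y \<in> ob D. \<exists>x \<in> ob C. isomorphic D (Fo x) y)"


section \<open>Additive categories\<close>

record ('o, 'm) add_cat = "('o, 'm) cat" +
  plus_arr :: "'m \<Rightarrow> 'm \<Rightarrow> 'm"  (infixl "\<boxplus>\<index>" 65)
  zero_arr :: "'o \<Rightarrow> 'o \<Rightarrow> 'm"

definition hom_group :: "('o, 'm, 'z) add_cat_scheme \<Rightarrow> 'o \<Rightarrow> 'o \<Rightarrow> 'm monoid" where
  "hom_group A x y = \<lparr>carrier = Hom A x y, monoid.mult = plus_arr A, one = zero_arr A x y\<rparr>"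

definition uminus_arr :: "('o, 'm, 'z) add_cat_scheme \<Rightarrow> 'm \<Rightarrow> 'm" where
  "uminus_arr A f = m_inv (hom_group A (src A f) (tgt A f)) f"

text \<open>The object \<open>z\<close> is a biproduct of \<open>x\<close> and \<open>y\<close> with injections \<open>i\<close>, \<open>j\<close> and projections
  \<open>p\<close>, \<open>q\<close>.\<close>

definition biproduct ::
  "('o, 'm, 'z) add_cat_scheme \<Rightarrow> 'o \<Rightarrow> 'o \<Rightarrow> 'o \<Rightarrow> 'm \<Rightarrow> 'm \<Rightarrow> 'm \<Rightarrow> 'm \<Rightarrow> bool" where
  "biproduct A x y z i j p q \<longleftrightarrow>
     x \<in> ob A \<and> y \<in> ob A \<and> z \<in> ob A \<and>
     i \<in> Hom A x z \<and> j \<in> Hom A y z \<and> p \<in> Hom A z x \<and> q \<in> Hom A z y \<and>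
     p \<cdot>\<^bsub>A\<^esub> i = idn A x \<and> q \<cdot>\<^bsub>A\<^esub> j = idn A y \<and>
     p \<cdot>\<^bsub>A\<^esub> j = zero_arr A y x \<and> q \<cdot>\<^bsub>A\<^esub> i = zero_arr A x y \<and>
     (i \<cdot>\<^bsub>A\<^esub> p) \<boxplus>\<^bsub>A\<^esub> (j \<cdot>\<^bsub>A\<^esub> q) = idn A z"

definition direct_summand :: "('o, 'm, 'z) add_cat_scheme \<Rightarrow> 'o \<Rightarrow> 'o \<Rightarrow> bool" where
  "direct_summand A x z \<longleftrightarrow> (\<exists>y i j p q. biproduct A x y z i j p q)"

locale additive_category = category A
  for A :: "('o, 'm, 'z) add_cat_scheme" (structure) +
  assumes hom_group: "\<lbrakk>x \<in> ob A; y \<in> ob A\<rbrakk> \<Longrightarrow> comm_group (hom_group A x y)"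
    and cmp_plus: "\<lbrakk>f \<in> Hom A x y; g \<in> Hom A y z; g' \<in> Hom A y z\<rbrakk>
          \<Longrightarrow> (g \<boxplus> g') \<cdot> f = (g \<cdot> f) \<boxplus> (g' \<cdot> f)"
    and plus_cmp: "\<lbrakk>f \<in> Hom A x y; f' \<in> Hom A x y; g \<in> Hom A y z\<rbrakk>
          \<Longrightarrow> g \<cdot> (f \<boxplus> f') = (g \<cdot> f) \<boxplus> (g \<cdot> f')"
    and ex_zero_object: "\<exists>z. zero_object A z"
    and ex_biproduct: "\<lbrakk>x \<in> ob A; y \<in> ob A\<rbrakk> \<Longrightarrow> \<exists>z i j p q. biproduct A x y z i j p q"

definition additive_functor ::
  "('o, 'm, 'z) add_cat_scheme \<Rightarrow> ('p, 'n, 'w) add_cat_scheme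
     \<Rightarrow> ('o \<Rightarrow> 'p) \<Rightarrow> ('m \<Rightarrow> 'n) \<Rightarrow> bool" where
  "additive_functor A B Fo Fa \<longleftrightarrow> is_functor A B Fo Fa \<and>
     (\<forall>x \<in> ob A. \<forall>y \<in> ob A. \<forall>f \<in> Hom A x y. \<forall>g \<in> Hom A x y.
        Fa (f \<boxplus>\<^bsub>A\<^esub> g) = Fa f \<boxplus>\<^bsub>B\<^esub> Fa g)"


section \<open>Triangulated categories\<close>

text \<open>A triangle \<open>x \<rightarrow> y \<rightarrow> z \<rightarrow> \<Sigma>x\<close> is encoded by its three arrows; the objects are recovered
  as their sources and targets. The shift is an autoequivalence, not necessarily an
  automorphism.\<close>

record ('o, 'm) tri_cat = "('o, 'm) add_cat" +
  shift_ob  :: "'o \<Rightarrow> 'o"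
  shift_arr :: "'m \<Rightarrow> 'm"
  dist      :: "('m \<times> 'm \<times> 'm) set"

definition triangle :: "('o, 'm, 'z) tri_cat_scheme \<Rightarrow> 'm \<times> 'm \<times> 'm \<Rightarrow> bool" where
  "triangle T = (\<lambda>(f, g, h). f \<in> arr T \<and> g \<in> arr T \<and> h \<in> arr T \<and>
     tgt T f = src T g \<and> tgt T g = src T h \<and> tgt T h = shift_ob T (src T f))"

definition triangle_morphism ::
  "('o, 'm, 'z) tri_cat_scheme \<Rightarrow> 'm \<times> 'm \<times> 'm \<Rightarrow> 'm \<times> 'm \<times> 'm \<Rightarrow> 'm \<Rightarrow> 'm \<Rightarrow> 'm \<Rightarrow> bool" where
  "triangle_morphism T = (\<lambda>(f, g, h) (f', g', h') a b c.
     a \<in> Hom T (src T f) (src T f') \<and>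
     b \<in> Hom T (src T g) (src T g') \<and>
     c \<in> Hom T (src T h) (src T h') \<and>
     b \<cdot>\<^bsub>T\<^esub> f = f' \<cdot>\<^bsub>T\<^esub> a \<and> c \<cdot>\<^bsub>T\<^esub> g = g' \<cdot>\<^bsub>T\<^esub> b \<and> shift_arr T a \<cdot>\<^bsub>T\<^esub> h = h' \<cdot>\<^bsub>T\<^esub> c)"

locale triangulated_category = additive_category T
  for T :: "('o, 'm, 'z) tri_cat_scheme" (structure) +
  assumes shift_additive: "additive_functor T T (shift_ob T) (shift_arr T)"
    and shift_equivalence: "equivalence T T (shift_ob T) (shift_arr T)"
    and dist_triangle: "t \<in> dist T \<Longrightarrow> triangle T t"
    and TR1_iso:
      "\<lbrakk>t \<in> dist T; triangle T t'; triangle_morphism T t t' a b c;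
        iso_arr T a; iso_arr T b; iso_arr T c\<rbrakk> \<Longrightarrow> t' \<in> dist T"
    and TR1_idn:
      "\<lbrakk>x \<in> ob T; zero_object T z\<rbrakk>
        \<Longrightarrow> (idn T x, zero_arr T x z, zero_arr T z (shift_ob T x)) \<in> dist T"
    and TR1_cone: "f \<in> arr T \<Longrightarrow> \<exists>g h. (f, g, h) \<in> dist T"
    and TR2:
      "triangle T (f, g, h)
        \<Longrightarrow> (f, g, h) \<in> dist T \<longleftrightarrow> (g, h, uminus_arr T (shift_arr T f)) \<in> dist T"
    and TR3:
      "\<lbrakk>(f, g, h) \<in> dist T; (f', g', h') \<in> dist T;
        a \<in> Hom T (src T f) (src T f'); b \<in> Hom T (src T g) (src T g'); b \<cdot> f = f' \<cdot> a\<rbrakk>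
        \<Longrightarrow> \<exists>c. triangle_morphism T (f, g, h) (f', g', h') a b c"
    and TR4:
      "\<lbrakk>f \<in> Hom T x y; g \<in> Hom T y z;
        (f, p1, d1) \<in> dist T; (g \<cdot> f, p2, d2) \<in> dist T; (g, p3, d3) \<in> dist T\<rbrakk>
        \<Longrightarrow> \<exists>a b. (a, b, shift_arr T p1 \<cdot> d3) \<in> dist T
              \<and> triangle_morphism T (f, p1, d1) (g \<cdot> f, p2, d2) (idn T x) g a
              \<and> triangle_morphism T (g \<cdot> f, p2, d2) (g, p3, d3) f (idn T z) b"

definition exact_functor ::
  "('o, 'm, 'z) tri_cat_scheme \<Rightarrow> ('p, 'n, 'w) tri_cat_scheme
     \<Rightarrow> ('o \<Rightarrow> 'p) \<Rightarrow> ('m \<Rightarrow> 'n) \<Rightarrow> bool" where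
  "exact_functor S T Fo Fa \<longleftrightarrow> additive_functor S T Fo Fa \<and>
     (\<exists>\<phi>. natural_iso S T
            (\<lambda>x. Fo (shift_ob S x)) (\<lambda>f. Fa (shift_arr S f))
            (\<lambda>x. shift_ob T (Fo x)) (\<lambda>f. shift_arr T (Fa f)) \<phi> \<and>
          (\<forall>f g h. (f, g, h) \<in> dist S \<longrightarrow> (Fa f, Fa g, \<phi> (src S f) \<cdot>\<^bsub>T\<^esub> Fa h) \<in> dist T))"


section \<open>Monoidal-triangulated categories\<close>

record ('o, 'm) mt_cat = "('o, 'm) tri_cat" +
  tensor_ob  :: "'o \<Rightarrow> 'o \<Rightarrow> 'o"  (infixl "\<odot>\<index>" 70)
  tensor_arr :: "'m \<Rightarrow> 'm \<Rightarrow> 'm"  (infixl "\<star>\<index>" 75)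
  unit_ob    :: "'o"
  associator :: "'o \<Rightarrow> 'o \<Rightarrow> 'o \<Rightarrow> 'm"
  lunitor    :: "'o \<Rightarrow> 'm"
  runitor    :: "'o \<Rightarrow> 'm"

locale monoidal_category = category K
  for K :: "('o, 'm, 'z) mt_cat_scheme" (structure) +
  assumes tensor_ob: "\<lbrakk>x \<in> ob K; y \<in> ob K\<rbrakk> \<Longrightarrow> x \<odot> y \<in> ob K"
    and tensor_arr: "\<lbrakk>f \<in> Hom K x x'; g \<in> Hom K y y'\<rbrakk> \<Longrightarrow> f \<star> g \<in> Hom K (x \<odot> y) (x' \<odot> y')"
    and tensor_idn: "\<lbrakk>x \<in> ob K; y \<in> ob K\<rbrakk> \<Longrightarrow> idn K x \<star> idn K y = idn K (x \<odot> y)"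
    and tensor_cmp:
      "\<lbrakk>f \<in> Hom K x x'; f' \<in> Hom K x' x''; g \<in> Hom K y y'; g' \<in> Hom K y' y''\<rbrakk>
        \<Longrightarrow> (f' \<cdot> f) \<star> (g' \<cdot> g) = (f' \<star> g') \<cdot> (f \<star> g)"
    and unit_ob: "unit_ob K \<in> ob K"
    and associator_Hom: "\<lbrakk>x \<in> ob K; y \<in> ob K; z \<in> ob K\<rbrakk>
          \<Longrightarrow> associator K x y z \<in> Hom K ((x \<odot> y) \<odot> z) (x \<odot> (y \<odot> z))"
    and associator_iso: "\<lbrakk>x \<in> ob K; y \<in> ob K; z \<in> ob K\<rbrakk> \<Longrightarrow> iso_arr K (associator K x y z)"
    and associator_natural:
      "\<lbrakk>f \<in> Hom K x x'; g \<in> Hom K y y'; h \<in> Hom K z z'\<rbrakk>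
        \<Longrightarrow> (f \<star> (g \<star> h)) \<cdot> associator K x y z = associator K x' y' z' \<cdot> ((f \<star> g) \<star> h)"
    and lunitor_Hom: "x \<in> ob K \<Longrightarrow> lunitor K x \<in> Hom K (unit_ob K \<odot> x) x"
    and lunitor_iso: "x \<in> ob K \<Longrightarrow> iso_arr K (lunitor K x)"
    and lunitor_natural:
      "f \<in> Hom K x y \<Longrightarrow> f \<cdot> lunitor K x = lunitor K y \<cdot> (idn K (unit_ob K) \<star> f)"
    and runitor_Hom: "x \<in> ob K \<Longrightarrow> runitor K x \<in> Hom K (x \<odot> unit_ob K) x"
    and runitor_iso: "x \<in> ob K \<Longrightarrow> iso_arr K (runitor K x)"
    and runitor_natural:
      "f \<in> Hom K x y \<Longrightarrow> f \<cdot> runitor K x = runitor K y \<cdot> (f \<star> idn K (unit_ob K))"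
    and pentagon:
      "\<lbrakk>w \<in> ob K; x \<in> ob K; y \<in> ob K; z \<in> ob K\<rbrakk>
        \<Longrightarrow> associator K w x (y \<odot> z) \<cdot> associator K (w \<odot> x) y z =
            (idn K w \<star> associator K x y z) \<cdot> associator K w (x \<odot> y) z
              \<cdot> (associator K w x y \<star> idn K z)"
    and triangle_identity:
      "\<lbrakk>x \<in> ob K; y \<in> ob K\<rbrakk>
        \<Longrightarrow> (idn K x \<star> lunitor K y) \<cdot> associator K x (unit_ob K) y = runitor K x \<star> idn K y"

locale monoidal_triangulated_category =
  triangulated_category K + monoidal_category K
  for K :: "('o, 'm, 'z) mt_cat_scheme" (structure) +
  assumes tensor_left_exact:
      "x \<in> ob K \<Longrightarrow> exact_functor K K (\<lambda>y. x \<odot> y) (\<lambda>f. idn K x \<star> f)"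
    and tensor_right_exact:
      "x \<in> ob K \<Longrightarrow> exact_functor K K (\<lambda>y. y \<odot> x) (\<lambda>f. f \<star> idn K x)"

text \<open>\<open>dual_pair K d x\<close> says that \<open>d\<close> is a left dual of \<open>x\<close>, equivalently that \<open>x\<close> is a right
  dual of \<open>d\<close>.\<close>

definition dual_pair :: "('o, 'm, 'z) mt_cat_scheme \<Rightarrow> 'o \<Rightarrow> 'o \<Rightarrow> bool" where
  "dual_pair K d x \<longleftrightarrow> d \<in> ob K \<and> x \<in> ob K \<and>
     (\<exists>ev \<in> Hom K (d \<odot>\<^bsub>K\<^esub> x) (unit_ob K). \<exists>coev \<in> Hom K (unit_ob K) (x \<odot>\<^bsub>K\<^esub> d).
        runitor K x \<cdot>\<^bsub>K\<^esub> (idn K x \<star>\<^bsub>K\<^esub> ev) \<cdot>\<^bsub>K\<^esub> associator K x d x \<cdot>\<^bsub>K\<^esub> (coev \<star>\<^bsub>K\<^esub> idn K x)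
          = lunitor K x \<and>
        lunitor K d \<cdot>\<^bsub>K\<^esub> (ev \<star>\<^bsub>K\<^esub> idn K d) \<cdot>\<^bsub>K\<^esub> inv_arr K (associator K d x d) \<cdot>\<^bsub>K\<^esub> (idn K d \<star>\<^bsub>K\<^esub> coev)
          = runitor K d)"

definition rigid :: "('o, 'm, 'z) mt_cat_scheme \<Rightarrow> bool" where
  "rigid K \<longleftrightarrow> (\<forall>x \<in> ob K. (\<exists>d. dual_pair K d x) \<and> (\<exists>d. dual_pair K x d))"


section \<open>Thick ideals\<close>

text \<open>Full subcategories are given by their sets of objects. A full triangulated subcategory
  contains the zero objects, is closed under the shift and its inverse, and contains the third
  object of a distinguished triangle as soon as it contains two of them. Closure under
  isomorphism is subsumed by closure under direct summands.\<close>

definition thick_subcategory :: "('o, 'm, 'z) tri_cat_scheme \<Rightarrow> 'o set \<Rightarrow> bool" where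
  "thick_subcategory T S \<longleftrightarrow> S \<subseteq> ob T \<and>
     (\<forall>z. zero_object T z \<longrightarrow> z \<in> S) \<and>
     (\<forall>x \<in> ob T. x \<in> S \<longleftrightarrow> shift_ob T x \<in> S) \<and>
     (\<forall>f g h. (f, g, h) \<in> dist T \<longrightarrow>
        (src T f \<in> S \<and> src T g \<in> S \<longrightarrow> src T h \<in> S) \<and>
        (src T g \<in> S \<and> src T h \<in> S \<longrightarrow> src T f \<in> S) \<and>
        (src T f \<in> S \<and> src T h \<in> S \<longrightarrow> src T g \<in> S)) \<and>
     (\<forall>x z. direct_summand T x z \<and> z \<in> S \<longrightarrow> x \<in> S)"

definition thick_generated :: "('o, 'm, 'z) tri_cat_scheme \<Rightarrow> 'o set \<Rightarrow> 'o set" where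
  "thick_generated T X = \<Inter>{S. thick_subcategory T S \<and> X \<subseteq> S}"

definition thick_ideal :: "('o, 'm, 'z) mt_cat_scheme \<Rightarrow> 'o set \<Rightarrow> bool" where
  "thick_ideal K J \<longleftrightarrow> thick_subcategory K J \<and>
     (\<forall>x \<in> J. \<forall>y \<in> ob K. x \<odot>\<^bsub>K\<^esub> y \<in> J \<and> y \<odot>\<^bsub>K\<^esub> x \<in> J)"

definition ideal_generated :: "('o, 'm, 'z) mt_cat_scheme \<Rightarrow> 'o set \<Rightarrow> 'o set" where
  "ideal_generated K X = \<Inter>{J. thick_ideal K J \<and> X \<subseteq> J}"

definition principal_ideal :: "('o, 'm, 'z) mt_cat_scheme \<Rightarrow> 'o set \<Rightarrow> bool" where
  "principal_ideal K J \<longleftrightarrow> (\<exists>x \<in> ob K. J = ideal_generated K {x})"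

definition prime_ideal :: "('o, 'm, 'z) mt_cat_scheme \<Rightarrow> 'o set \<Rightarrow> bool" where
  "prime_ideal K P \<longleftrightarrow> thick_ideal K P \<and> P \<noteq> ob K \<and>
     (\<forall>I J. thick_ideal K I \<and> thick_ideal K J \<and> {x \<odot>\<^bsub>K\<^esub> y | x y. x \<in> I \<and> y \<in> J} \<subseteq> P
        \<longrightarrow> I \<subseteq> P \<or> J \<subseteq> P)"

text \<open>Intersecting with \<open>ob K\<close> makes the empty intersection equal to \<open>ob K\<close>.\<close>

definition semiprime_ideal :: "('o, 'm, 'z) mt_cat_scheme \<Rightarrow> 'o set \<Rightarrow> bool" where
  "semiprime_ideal K J \<longleftrightarrow> (\<exists>\<P>. (\<forall>P \<in> \<P>. prime_ideal K P) \<and> J = ob K \<inter> \<Inter>\<P>)"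

definition semiprime_closure :: "('o, 'm, 'z) mt_cat_scheme \<Rightarrow> 'o \<Rightarrow> 'o set" where
  "semiprime_closure K x = \<Inter>{J. semiprime_ideal K J \<and> x \<in> J}"


section \<open>Central generation, compact detection, principal closedness\<close>

definition centralizes :: "('o, 'm, 'z) mt_cat_scheme \<Rightarrow> 'o \<Rightarrow> 'o set \<Rightarrow> bool" where
  "centralizes K x I \<longleftrightarrow> (\<forall>y \<in> I. isomorphic K (x \<odot>\<^bsub>K\<^esub> y) (y \<odot>\<^bsub>K\<^esub> x))"

definition weak_central_generation :: "('o, 'm, 'z) mt_cat_scheme \<Rightarrow> 'o set \<Rightarrow> bool" where
  "weak_central_generation K I \<longleftrightarrow>
     I \<subseteq> ob K \<and> thick_generated K I = ob K \<and>
     (\<forall>J. thick_ideal K J \<longrightarrow>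
        (\<exists>X \<subseteq> ob K. (\<forall>x \<in> X. centralizes K x I) \<and> J = ideal_generated K X))"

definition compact_detection :: "('o, 'm, 'z) mt_cat_scheme \<Rightarrow> bool" where
  "compact_detection K \<longleftrightarrow>
     (\<forall>x \<in> ob K. \<exists>s \<in> ob K. \<forall>J. semiprime_ideal K J \<longrightarrow>
        (x \<in> J \<longleftrightarrow> (x \<odot>\<^bsub>K\<^esub> s) \<odot>\<^bsub>K\<^esub> x \<in> J))"

definition principally_closed :: "('o, 'm, 'z) mt_cat_scheme \<Rightarrow> bool" where
  "principally_closed K \<longleftrightarrow>
     (\<forall>x \<in> ob K. \<forall>y \<in> ob K. \<exists>z \<in> ob K.
        semiprime_closure K x \<inter> semiprime_closure K y = semiprime_closure K z)"

end

(* A thick ideal generated by a set X is the union of the ideals generated by the finite subsets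
   of X, and finitely many generators may be replaced by their direct sum. Direct sums of objects
   centralizing I centralize I, so weak central generation provides a single centralizing
   generator for every principal ideal.
   If x centralizes I and a prime P contains x y, then the objects k with x k y in P form
   a thick subcategory containing I, hence are all objects, and so x or y lies in P. Thus the
   primes containing x y are those containing x or y, and <x>_s and <y>_s intersect in <x y>_s.
   In a rigid category the zigzag identity makes x a retract of x d x for a dual d of x; retracts
   are direct summands in a triangulated category, so s_x = d works. *)

theory Submission
  imports Defs
begin

section \<open>Isomorphisms, zero objects and functors in plain categories\<close>

section \<open>Categories\<close>

context category
begin

lemma Hom_ob:
  assumes "f \<in> Hom C x y"
  shows "x \<in> ob C" "y \<in> ob C"
  using assms src_ob tgt_ob by (auto simp: Hom_def)

lemma cmp_simps:
  assumes "f \<in> arr C" "g \<in> arr C" "tgt C f = src C g"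
  shows "g \<cdot> f \<in> arr C" "src C (g \<cdot> f) = src C f" "tgt C (g \<cdot> f) = tgt C g"
  using cmp_Hom[of f "src C f" "src C g" g "tgt C g"] assms by (auto simp: Hom_def)

lemma cmp_assoc_arr:
  "\<lbrakk>f \<in> arr C; g \<in> arr C; h \<in> arr C; tgt C f = src C g; tgt C g = src C h\<rbrakk>
    \<Longrightarrow> (h \<cdot> g) \<cdot> f = h \<cdot> (g \<cdot> f)"
  using cmp_assoc by (auto simp: Hom_def)

lemma isomorphicE:
  assumes "isomorphic C x y"
  obtains f g where "f \<in> Hom C x y" "g \<in> Hom C y x"
    "g \<cdot> f = idn C x" "f \<cdot> g = idn C y"
  using assms unfolding isomorphic_def iso_arr_def inverse_arrs_def by (auto simp: Hom_def)

lemma isomorphicI: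
  assumes "f \<in> Hom C x y" "g \<in> Hom C y x" "g \<cdot> f = idn C x" "f \<cdot> g = idn C y"
  shows "isomorphic C x y"
  using assms unfolding isomorphic_def iso_arr_def inverse_arrs_def by (auto simp: Hom_def)

lemma zero_objects_isomorphic:
  assumes "zero_object C x" "zero_object C y"
  shows "isomorphic C x y"
proof -
  have ob: "x \<in> ob C" "y \<in> ob C"
    using assms by (auto simp: zero_object_def)
  obtain f g where fg: "f \<in> Hom C x y" "g \<in> Hom C y x"
    using assms ob unfolding zero_object_def by metis
  have "g \<cdot> f = idn C x" "f \<cdot> g = idn C y"
    using cmp_Hom[OF fg] cmp_Hom[OF fg(2,1)] idn_Hom ob assms
    unfolding zero_object_def by metis+
  with fg show ?thesis
    by (rule isomorphicI)
qed

end

lemma is_functorD: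
  assumes "is_functor C D Fo Fa"
  shows "x \<in> ob C \<Longrightarrow> Fo x \<in> ob D"
    and "x \<in> ob C \<Longrightarrow> Fa (idn C x) = idn D (Fo x)"
    and "f \<in> Hom C x y \<Longrightarrow> Fa f \<in> Hom D (Fo x) (Fo y)"
    and "\<lbrakk>f \<in> Hom C x y; g \<in> Hom C y z\<rbrakk> \<Longrightarrow> Fa (g \<cdot>\<^bsub>C\<^esub> f) = Fa g \<cdot>\<^bsub>D\<^esub> Fa f"
  using assms by (auto simp: is_functor_def Hom_def)

lemma functor_isomorphic:
  assumes "category C" "category D" "is_functor C D Fo Fa" "isomorphic C x y"
  shows "isomorphic D (Fo x) (Fo y)"
proof -
  interpret C: category C by fact
  interpret D: category D by fact
  note F = is_functorD[OF assms(3)]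
  obtain f g where fg: "f \<in> Hom C x y" "g \<in> Hom C y x"
    "g \<cdot>\<^bsub>C\<^esub> f = idn C x" "f \<cdot>\<^bsub>C\<^esub> g = idn C y"
    using C.isomorphicE[OF assms(4)] .
  show ?thesis
    by (rule D.isomorphicI[of "Fa f" _ _ "Fa g"])
      (use fg F C.Hom_ob[OF fg(1)] in \<open>auto simp: F(4)[symmetric]\<close>)
qed


section \<open>Arithmetic of hom groups, biproducts and additive functors\<close>

section \<open>Additive categories\<close>

context additive_category
begin

text \<open>The library writes the group law of \<open>hom_group A x y\<close> multiplicatively;
  this transfers it to additive notation on arrows. In \<open>ex_minus\<close>, \<open>n\<close> is
  the difference \<open>g - f\<close>, so no separate negation has to be carried along.\<close>

lemma
  assumes "x \<in> ob A" "y \<in> ob A"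
  shows zero_Hom: "zero_arr A x y \<in> Hom A x y"
    and zero_plus: "f \<in> Hom A x y \<Longrightarrow> zero_arr A x y \<boxplus> f = f"
    and plus_zero: "f \<in> Hom A x y \<Longrightarrow> f \<boxplus> zero_arr A x y = f"
    and minus_zero: "m_inv (hom_group A x y) (zero_arr A x y) = zero_arr A x y"
    and ex_minus: "f \<in> Hom A x y \<Longrightarrow> g \<in> Hom A x y \<Longrightarrow> \<exists>n \<in> Hom A x y. f \<boxplus> n = g"
proof -
  interpret H: comm_group "hom_group A x y"
    using assms by (rule hom_group)
  show "zero_arr A x y \<in> Hom A x y"
    using H.one_closed by (simp add: hom_group_def)
  show "f \<in> Hom A x y \<Longrightarrow> zero_arr A x y \<boxplus> f = f"
    using H.l_one[of f] by (simp add: hom_group_def)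
  show "f \<in> Hom A x y \<Longrightarrow> f \<boxplus> zero_arr A x y = f"
    using H.r_one[of f] by (simp add: hom_group_def)
  show "m_inv (hom_group A x y) (zero_arr A x y) = zero_arr A x y"
    using H.inv_one by (simp add: hom_group_def)
  assume fg: "f \<in> Hom A x y" "g \<in> Hom A x y"
  let ?n = "m_inv (hom_group A x y) f \<otimes>\<^bsub>hom_group A x y\<^esub> g"
  have c: "f \<in> carrier (hom_group A x y)" "g \<in> carrier (hom_group A x y)"
    using fg by (simp_all add: hom_group_def)
  have "?n \<in> carrier (hom_group A x y)" "f \<otimes>\<^bsub>hom_group A x y\<^esub> ?n = g"
    using c by (simp_all add: H.m_assoc[symmetric])
  then show "\<exists>n \<in> Hom A x y. f \<boxplus> n = g"
    by (auto simp: hom_group_def)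
qed

lemma
  assumes "f \<in> Hom A x y" "g \<in> Hom A x y"
  shows plus_Hom: "f \<boxplus> g \<in> Hom A x y"
    and plus_left_cancel: "h \<in> Hom A x y \<Longrightarrow> f \<boxplus> g = f \<boxplus> h \<longleftrightarrow> g = h"
proof -
  interpret H: comm_group "hom_group A x y"
    using Hom_ob[OF assms(1)] by (rule hom_group)
  show "f \<boxplus> g \<in> Hom A x y"
    using H.m_closed[of f g] assms by (simp add: hom_group_def)
  show "h \<in> Hom A x y \<Longrightarrow> f \<boxplus> g = f \<boxplus> h \<longleftrightarrow> g = h"
    using H.Units_l_cancel[unfolded H.Units_eq, of f g h] assms by (simp add: hom_group_def)
qed

text \<open>Cancelling one copy of \<open>f\<close> suffices. Composites with zero arrows and images
  of zero arrows under additive functors are shown to vanish in this way.\<close>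

lemma plus_idem:
  assumes "f \<in> Hom A x y" "f \<boxplus> f = f"
  shows "f = zero_arr A x y"
  using assms Hom_ob[OF assms(1)] plus_left_cancel[of f x y f "zero_arr A x y"]
  by (simp add: zero_Hom plus_zero)

lemma zero_cmp:
  assumes "f \<in> Hom A x y" "z \<in> ob A"
  shows "zero_arr A y z \<cdot> f = zero_arr A x z"
proof (rule plus_idem)
  have 0: "zero_arr A y z \<in> Hom A y z"
    using Hom_ob[OF assms(1)] assms(2) by (simp add: zero_Hom)
  show "zero_arr A y z \<cdot> f \<in> Hom A x z"
    by (rule cmp_Hom[OF assms(1) 0])
  show "zero_arr A y z \<cdot> f \<boxplus> zero_arr A y z \<cdot> f = zero_arr A y z \<cdot> f"
    using cmp_plus[OF assms(1) 0 0] Hom_ob[OF 0] by (simp add: zero_plus[OF _ _ 0])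
qed

lemma cmp_zero:
  assumes "f \<in> Hom A x y" "w \<in> ob A"
  shows "f \<cdot> zero_arr A w x = zero_arr A w y"
proof (rule plus_idem)
  have 0: "zero_arr A w x \<in> Hom A w x"
    using Hom_ob[OF assms(1)] assms(2) by (simp add: zero_Hom)
  show "f \<cdot> zero_arr A w x \<in> Hom A w y"
    by (rule cmp_Hom[OF 0 assms(1)])
  show "f \<cdot> zero_arr A w x \<boxplus> f \<cdot> zero_arr A w x = f \<cdot> zero_arr A w x"
    using plus_cmp[OF 0 0 assms(1)] Hom_ob[OF 0] by (simp add: zero_plus[OF _ _ 0])
qed

lemma zero_objectD:
  assumes "zero_object A z"
  shows "z \<in> ob A"
    and "f \<in> Hom A x z \<Longrightarrow> f = zero_arr A x z"
    and "f \<in> Hom A z x \<Longrightarrow> f = zero_arr A z x"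
proof -
  show z: "z \<in> ob A"
    using assms by (simp add: zero_object_def)
  show "f = zero_arr A x z" if f: "f \<in> Hom A x z"
    using assms f zero_Hom[OF Hom_ob[OF f]] Hom_ob[OF f] unfolding zero_object_def by blast
  show "f = zero_arr A z x" if f: "f \<in> Hom A z x"
    using assms f zero_Hom[OF Hom_ob[OF f]] Hom_ob[OF f] unfolding zero_object_def by blast
qed

text \<open>Every arrow into or out of \<open>z\<close> factors through \<open>idn A z\<close> and
  so vanishes once the identity does. Unlike the universal property, this equation is visibly
  preserved by additive functors.\<close>

lemma zero_object_iff:
  "zero_object A z \<longleftrightarrow> z \<in> ob A \<and> idn A z = zero_arr A z z"
proof
  assume "zero_object A z"
  then show "z \<in> ob A \<and> idn A z = zero_arr A z z"
    using zero_objectD idn_Hom by blast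
next
  assume z: "z \<in> ob A \<and> idn A z = zero_arr A z z"
  have "f = zero_arr A x z" if "f \<in> Hom A x z" for f x
    using idn_cmp[OF that] zero_cmp[OF that, of z] z by simp
  moreover have "f = zero_arr A z x" if "f \<in> Hom A z x" for f x
    using cmp_idn[OF that] cmp_zero[OF that, of z] z by simp
  ultimately show "zero_object A z"
    using z zero_Hom unfolding zero_object_def by blast
qed

text \<open>Stated for one-sided inverses \<open>a'\<close>, \<open>b'\<close> so that it yields both identities for an
  isomorphism of biproducts.\<close>

lemma biproduct_map_inverse:
  assumes "biproduct A x y z i j p q" "biproduct A x' y' z' i' j' p' q'"
    and a: "a \<in> Hom A x x'" "a' \<in> Hom A x' x" "a' \<cdot> a = idn A x"
    and b: "b \<in> Hom A y y'" "b' \<in> Hom A y' y" "b' \<cdot> b = idn A y"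
  shows "(i \<cdot> (a' \<cdot> p') \<boxplus> j \<cdot> (b' \<cdot> q')) \<cdot> (i' \<cdot> (a \<cdot> p) \<boxplus> j' \<cdot> (b \<cdot> q)) = idn A z"
    (is "?g \<cdot> _ = _")
proof -
  have B: "x \<in> ob A" "y \<in> ob A" "z \<in> ob A"
      "i \<in> Hom A x z" "j \<in> Hom A y z" "p \<in> Hom A z x" "q \<in> Hom A z y"
      "i \<cdot> p \<boxplus> j \<cdot> q = idn A z"
    using assms(1) by (auto simp: biproduct_def)
  have B': "x' \<in> ob A" "y' \<in> ob A" "z' \<in> ob A"
      "i' \<in> Hom A x' z'" "j' \<in> Hom A y' z'" "p' \<in> Hom A z' x'" "q' \<in> Hom A z' y'"
      "p' \<cdot> i' = idn A x'" "q' \<cdot> j' = idn A y'"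
      "p' \<cdot> j' = zero_arr A y' x'" "q' \<cdot> i' = zero_arr A x' y'"
    using assms(2) by (auto simp: biproduct_def)
  have ap: "a' \<cdot> p' \<in> Hom A z' x" "b' \<cdot> q' \<in> Hom A z' y" "a \<cdot> p \<in> Hom A z x'" "b \<cdot> q \<in> Hom A z y'"
    using B B' a b cmp_Hom by blast+
  have iap: "i \<cdot> (a' \<cdot> p') \<in> Hom A z' z" "j \<cdot> (b' \<cdot> q') \<in> Hom A z' z"
      "i' \<cdot> (a \<cdot> p) \<in> Hom A z z'" "j' \<cdot> (b \<cdot> q) \<in> Hom A z z'"
    using ap B B' cmp_Hom by blast+
  have ia: "i \<cdot> a' \<in> Hom A x' z" "j \<cdot> b' \<in> Hom A y' z"
    using B a b cmp_Hom by blast+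
  have g: "?g \<in> Hom A z' z"
    using iap by (simp add: plus_Hom)
  \<comment> \<open>The map is first computed on the injections \<open>i'\<close> and
    \<open>j'\<close>, where the biproduct relations remove the cross terms.\<close>
  have "?g \<cdot> i' = (i \<cdot> a') \<cdot> (p' \<cdot> i') \<boxplus> (j \<cdot> b') \<cdot> (q' \<cdot> i')"
    using cmp_plus[OF B'(4) iap(1,2)] B(1-7) B'(1-7) a(2) b(2)
    by (simp add: Hom_def cmp_assoc_arr cmp_simps)
  also have "\<dots> = i \<cdot> a'"
    using cmp_idn[OF ia(1)] cmp_zero[OF ia(2)] B B' ia by (simp add: plus_zero)
  finally have gi: "?g \<cdot> i' = i \<cdot> a'" .
  have "?g \<cdot> j' = (i \<cdot> a') \<cdot> (p' \<cdot> j') \<boxplus> (j \<cdot> b') \<cdot> (q' \<cdot> j')"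
    using cmp_plus[OF B'(5) iap(1,2)] B(1-7) B'(1-7) a(2) b(2)
    by (simp add: Hom_def cmp_assoc_arr cmp_simps)
  also have "\<dots> = j \<cdot> b'"
    using cmp_zero[OF ia(1)] cmp_idn[OF ia(2)] B B' ia by (simp add: zero_plus)
  finally have gj: "?g \<cdot> j' = j \<cdot> b'" .
  have ida: "a' \<cdot> (a \<cdot> p) = p" "b' \<cdot> (b \<cdot> q) = q"
    using cmp_assoc[OF B(6) a(1,2)] cmp_assoc[OF B(7) b(1,2)] a b B by (simp_all add: idn_cmp)
  have "?g \<cdot> (i' \<cdot> (a \<cdot> p) \<boxplus> j' \<cdot> (b \<cdot> q)) = (?g \<cdot> i') \<cdot> (a \<cdot> p) \<boxplus> (?g \<cdot> j') \<cdot> (b \<cdot> q)"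
    by (simp only: plus_cmp[OF iap(3,4) g] cmp_assoc[OF ap(3) B'(4) g] cmp_assoc[OF ap(4) B'(5) g])
  also have "\<dots> = i \<cdot> p \<boxplus> j \<cdot> q"
    by (simp only: gi gj cmp_assoc[OF ap(3) a(2) B(4)] cmp_assoc[OF ap(4) b(2) B(5)] ida)
  finally show ?thesis
    using B by simp
qed

text \<open>The isomorphism and its inverse are the diagonal matrices with entries \<open>a\<close>,
  \<open>b\<close> and \<open>a'\<close>, \<open>b'\<close>.\<close>

lemma biproduct_isomorphic:
  assumes z: "biproduct A x y z i j p q" and z': "biproduct A x' y' z' i' j' p' q'"
    and "isomorphic A x x'" "isomorphic A y y'"
  shows "isomorphic A z z'"
proof -
  obtain a a' where a: "a \<in> Hom A x x'" "a' \<in> Hom A x' x" "a' \<cdot> a = idn A x" "a \<cdot> a' = idn A x'"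
    using isomorphicE[OF assms(3)] .
  obtain b b' where b: "b \<in> Hom A y y'" "b' \<in> Hom A y' y" "b' \<cdot> b = idn A y" "b \<cdot> b' = idn A y'"
    using isomorphicE[OF assms(4)] .
  have B: "i \<in> Hom A x z" "j \<in> Hom A y z" "p \<in> Hom A z x" "q \<in> Hom A z y"
    using z by (auto simp: biproduct_def)
  have B': "i' \<in> Hom A x' z'" "j' \<in> Hom A y' z'" "p' \<in> Hom A z' x'" "q' \<in> Hom A z' y'"
    using z' by (auto simp: biproduct_def)
  show ?thesis
  proof (rule isomorphicI)
    show "i' \<cdot> (a \<cdot> p) \<boxplus> j' \<cdot> (b \<cdot> q) \<in> Hom A z z'"
      using B B' a b by (blast intro: plus_Hom cmp_Hom)
    show "i \<cdot> (a' \<cdot> p') \<boxplus> j \<cdot> (b' \<cdot> q') \<in> Hom A z' z"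
      using B B' a b by (blast intro: plus_Hom cmp_Hom)
  qed (use biproduct_map_inverse[OF z z'] biproduct_map_inverse[OF z' z] a b in simp_all)
qed

end

lemma additive_functor_zero:
  assumes "additive_category A" "additive_category B" "additive_functor A B Fo Fa"
    and "x \<in> ob A" "y \<in> ob A"
  shows "Fa (zero_arr A x y) = zero_arr B (Fo x) (Fo y)"
proof -
  interpret A: additive_category A by fact
  interpret B: additive_category B by fact
  have F: "is_functor A B Fo Fa"
    using assms(3) by (simp add: additive_functor_def)
  have 0: "zero_arr A x y \<in> Hom A x y"
    using assms by (simp add: A.zero_Hom)
  show ?thesis
  proof (rule B.plus_idem)
    show "Fa (zero_arr A x y) \<in> Hom B (Fo x) (Fo y)"
      by (rule is_functorD(3)[OF F 0])
    have "Fa (zero_arr A x y) = Fa (zero_arr A x y \<boxplus>\<^bsub>A\<^esub> zero_arr A x y)"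
      using assms 0 by (simp add: A.zero_plus)
    also have "\<dots> = Fa (zero_arr A x y) \<boxplus>\<^bsub>B\<^esub> Fa (zero_arr A x y)"
      using assms 0 by (simp add: additive_functor_def)
    finally show "Fa (zero_arr A x y) \<boxplus>\<^bsub>B\<^esub> Fa (zero_arr A x y) = Fa (zero_arr A x y)"
      by simp
  qed
qed

lemma additive_functor_zero_object:
  assumes "additive_category A" "additive_category B" "additive_functor A B Fo Fa"
    and "zero_object A z"
  shows "zero_object B (Fo z)"
proof -
  interpret A: additive_category A by fact
  interpret B: additive_category B by fact
  have "is_functor A B Fo Fa"
    using assms(3) by (simp add: additive_functor_def)
  then show ?thesis
    using assms(4) is_functorD(1,2)[of A B Fo Fa z] additive_functor_zero[OF assms(1-3), of z z]
    by (simp add: A.zero_object_iff B.zero_object_iff)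
qed

text \<open>A biproduct is encoded by equations between sums and composites of arrows, all of which
  an additive functor respects.\<close>

lemma additive_functor_biproduct:
  assumes "additive_category A" "additive_category B" "additive_functor A B Fo Fa"
    and bip: "biproduct A x y z i j p q"
  shows "biproduct B (Fo x) (Fo y) (Fo z) (Fa i) (Fa j) (Fa p) (Fa q)"
proof -
  interpret A: additive_category A by fact
  interpret B: additive_category B by fact
  have F: "is_functor A B Fo Fa"
    using assms(3) by (simp add: additive_functor_def)
  note F' = is_functorD[OF F]
  have b: "x \<in> ob A" "y \<in> ob A" "z \<in> ob A"
      "i \<in> Hom A x z" "j \<in> Hom A y z" "p \<in> Hom A z x" "q \<in> Hom A z y"
    and e: "p \<cdot>\<^bsub>A\<^esub> i = idn A x" "q \<cdot>\<^bsub>A\<^esub> j = idn A y"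
      "p \<cdot>\<^bsub>A\<^esub> j = zero_arr A y x" "q \<cdot>\<^bsub>A\<^esub> i = zero_arr A x y"
      "(i \<cdot>\<^bsub>A\<^esub> p) \<boxplus>\<^bsub>A\<^esub> (j \<cdot>\<^bsub>A\<^esub> q) = idn A z"
    using bip by (auto simp: biproduct_def)
  have "Fa (i \<cdot>\<^bsub>A\<^esub> p) \<boxplus>\<^bsub>B\<^esub> Fa (j \<cdot>\<^bsub>A\<^esub> q) = Fa ((i \<cdot>\<^bsub>A\<^esub> p) \<boxplus>\<^bsub>A\<^esub> (j \<cdot>\<^bsub>A\<^esub> q))"
    using assms(3) b A.cmp_Hom[OF b(6,4)] A.cmp_Hom[OF b(7,5)] by (simp add: additive_functor_def)
  then have "(Fa i \<cdot>\<^bsub>B\<^esub> Fa p) \<boxplus>\<^bsub>B\<^esub> (Fa j \<cdot>\<^bsub>B\<^esub> Fa q) = idn B (Fo z)"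
    using b e F'(2) by (simp add: F'(4)[OF b(6,4)] F'(4)[OF b(7,5)])
  then show ?thesis
    using b e F' additive_functor_zero[OF assms(1-3)]
      F'(4)[OF b(4,6)] F'(4)[OF b(5,7)] F'(4)[OF b(5,6)] F'(4)[OF b(4,7)]
    by (auto simp: biproduct_def)
qed


section \<open>Closure properties of thick subcategories\<close>

section \<open>Thick subcategories\<close>

lemma thick_subcategoryI:
  assumes "S \<subseteq> ob T" "\<And>z. zero_object T z \<Longrightarrow> z \<in> S"
    and "\<And>x. x \<in> ob T \<Longrightarrow> x \<in> S \<longleftrightarrow> shift_ob T x \<in> S"
    and "\<And>f g h. \<lbrakk>(f, g, h) \<in> dist T; src T f \<in> S; src T g \<in> S\<rbrakk> \<Longrightarrow> src T h \<in> S"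
    and "\<And>f g h. \<lbrakk>(f, g, h) \<in> dist T; src T g \<in> S; src T h \<in> S\<rbrakk> \<Longrightarrow> src T f \<in> S"
    and "\<And>f g h. \<lbrakk>(f, g, h) \<in> dist T; src T f \<in> S; src T h \<in> S\<rbrakk> \<Longrightarrow> src T g \<in> S"
    and "\<And>x z. \<lbrakk>direct_summand T x z; z \<in> S\<rbrakk> \<Longrightarrow> x \<in> S"
  shows "thick_subcategory T S"
  unfolding thick_subcategory_def using assms by (intro conjI allI ballI impI; blast)

lemma
  assumes "thick_subcategory T S"
  shows thick_subset: "S \<subseteq> ob T"
    and thick_zero_object: "zero_object T z \<Longrightarrow> z \<in> S"
    and thick_shift: "x \<in> ob T \<Longrightarrow> shift_ob T x \<in> S \<longleftrightarrow> x \<in> S"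
    and thick_dist3: "\<lbrakk>(f, g, h) \<in> dist T; src T f \<in> S; src T g \<in> S\<rbrakk> \<Longrightarrow> src T h \<in> S"
    and thick_dist1: "\<lbrakk>(f, g, h) \<in> dist T; src T g \<in> S; src T h \<in> S\<rbrakk> \<Longrightarrow> src T f \<in> S"
    and thick_dist2: "\<lbrakk>(f, g, h) \<in> dist T; src T f \<in> S; src T h \<in> S\<rbrakk> \<Longrightarrow> src T g \<in> S"
    and thick_direct_summand: "\<lbrakk>direct_summand T x z; z \<in> S\<rbrakk> \<Longrightarrow> x \<in> S"
  using assms unfolding thick_subcategory_def by blast+

text \<open>Intersecting with \<open>ob T\<close> gives the empty family the value
  \<open>ob T\<close>, as in the definition of semiprime ideals.\<close>

lemma thick_subcategory_Inter:
  assumes "thick_subcategory T (ob T)" "\<And>S. S \<in> \<S> \<Longrightarrow> thick_subcategory T S"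
  shows "thick_subcategory T (ob T \<inter> \<Inter>\<S>)"
proof (rule thick_subcategoryI)
  show "x \<in> ob T \<inter> \<Inter>\<S> \<longleftrightarrow> shift_ob T x \<in> ob T \<inter> \<Inter>\<S>" if "x \<in> ob T" for x
    using assms[THEN thick_shift] that by auto
qed (use assms in \<open>auto intro: thick_zero_object thick_dist1 thick_dist2 thick_dist3
  thick_direct_summand\<close>)


section \<open>Split monomorphisms in triangulated categories, and preimages under exact
  functors\<close>

section \<open>Retracts and biproducts in triangulated categories\<close>

context triangulated_category
begin

lemma dist_objects:
  assumes "(f, g, h) \<in> dist T" "f \<in> Hom T x y"
  obtains z where "g \<in> Hom T y z" "h \<in> Hom T z (shift_ob T x)" "z \<in> ob T"
  using dist_triangle[OF assms(1)] assms(2) src_ob[of h]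
  by (auto simp: triangle_def Hom_def)

text \<open>By TR3 the pair \<open>idn T x\<close>, \<open>f\<close> extends to a morphism from the
  trivial triangle on \<open>x\<close>. The third object of that triangle is zero, so
  \<open>g \<cdot> f\<close> factors through a zero object.\<close>

lemma dist_cmp_zero:
  assumes "(f, g, h) \<in> dist T" "f \<in> Hom T x y" "g \<in> Hom T y z"
  shows "g \<cdot> f = zero_arr T x z"
proof -
  obtain Z where Z: "zero_object T Z"
    using ex_zero_object by blast
  have ob: "x \<in> ob T" "y \<in> ob T" "Z \<in> ob T" "z \<in> ob T" "shift_ob T x \<in> ob T"
    using Hom_ob assms zero_objectD(1)[OF Z] shift_additive
    by (auto simp: additive_functor_def is_functor_def)
  have 0: "zero_arr T x Z \<in> Hom T x Z" "zero_arr T Z (shift_ob T x) \<in> Hom T Z (shift_ob T x)"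
    using ob by (simp_all add: zero_Hom)
  have id: "idn T x \<in> Hom T x x"
    using ob by (simp add: idn_Hom)
  obtain c where "triangle_morphism T
      (idn T x, zero_arr T x Z, zero_arr T Z (shift_ob T x)) (f, g, h) (idn T x) f c"
    using TR3[OF TR1_idn[OF ob(1) Z] assms(1), of "idn T x" f] assms(2,3) 0 id
    by (auto simp: Hom_def)
  then have "c \<in> Hom T Z z" "c \<cdot> zero_arr T x Z = g \<cdot> f"
    using 0 dist_triangle[OF assms(1)] assms(3) by (auto simp: triangle_morphism_def Hom_def triangle_def)
  then show ?thesis
    using cmp_zero ob by metis
qed

text \<open>By TR3 the pair \<open>idn T x\<close>, \<open>r\<close> extends to a morphism to the
  trivial triangle on \<open>x\<close>. Its last square factors \<open>h\<close> through a zero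
  object.\<close>

lemma dist_split_mono:
  assumes "(f, g, h) \<in> dist T" "f \<in> Hom T x y" "h \<in> Hom T z (shift_ob T x)"
    and "r \<in> Hom T y x" "r \<cdot> f = idn T x"
  shows "h = zero_arr T z (shift_ob T x)"
proof -
  obtain Z where Z: "zero_object T Z"
    using ex_zero_object by blast
  have F: "is_functor T T (shift_ob T) (shift_arr T)"
    using shift_additive by (simp add: additive_functor_def)
  have ob: "x \<in> ob T" "y \<in> ob T" "Z \<in> ob T" "z \<in> ob T" "shift_ob T x \<in> ob T"
    using Hom_ob assms zero_objectD(1)[OF Z] by blast+
  have 0: "zero_arr T x Z \<in> Hom T x Z" "zero_arr T Z (shift_ob T x) \<in> Hom T Z (shift_ob T x)"
    using ob by (simp_all add: zero_Hom)
  have id: "idn T x \<in> Hom T x x"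
    using ob by (simp add: idn_Hom)
  have "src T g = y"
    using dist_triangle[OF assms(1)] assms(2) by (auto simp: Hom_def triangle_def)
  then obtain c where "triangle_morphism T (f, g, h)
      (idn T x, zero_arr T x Z, zero_arr T Z (shift_ob T x)) (idn T x) r c"
    using TR3[OF assms(1) TR1_idn[OF ob(1) Z], of "idn T x" r] assms(2-5) 0 id cmp_idn[OF id]
    by (auto simp: Hom_def)
  then have c: "c \<in> Hom T z Z" "shift_arr T (idn T x) \<cdot> h = zero_arr T Z (shift_ob T x) \<cdot> c"
    using 0 assms(3) by (auto simp: triangle_morphism_def Hom_def)
  then show ?thesis
    using zero_cmp[OF c(1) ob(5)] is_functorD(2)[OF F ob(1)] idn_cmp[OF assms(3)] by simp
qed

text \<open>Its rotation is the trivial triangle on \<open>y\<close> with the zero object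
  \<open>shift_ob T Z\<close> as third term. The sign in TR2 disappears because the rotated arrow is
  zero.\<close>

lemma zero_idn_dist:
  assumes "zero_object T Z" "y \<in> ob T"
  shows "(zero_arr T Z y, idn T y, zero_arr T y (shift_ob T Z)) \<in> dist T"
proof -
  have add: "additive_category T" ..
  have S: "zero_object T (shift_ob T Z)"
    by (rule additive_functor_zero_object[OF add add shift_additive assms(1)])
  have F: "is_functor T T (shift_ob T) (shift_arr T)"
    using shift_additive by (simp add: additive_functor_def)
  have ob: "Z \<in> ob T" "shift_ob T Z \<in> ob T" "shift_ob T y \<in> ob T"
    using zero_objectD(1) assms(1) S is_functorD(1)[OF F assms(2)] by auto
  have "shift_arr T (zero_arr T Z y) = zero_arr T (shift_ob T Z) (shift_ob T y)"
    by (rule additive_functor_zero[OF add add shift_additive ob(1) assms(2)])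
  moreover have "zero_arr T (shift_ob T Z) (shift_ob T y) \<in> Hom T (shift_ob T Z) (shift_ob T y)"
    using ob by (simp add: zero_Hom)
  ultimately have "uminus_arr T (shift_arr T (zero_arr T Z y)) = zero_arr T (shift_ob T Z) (shift_ob T y)"
    using ob by (simp add: uminus_arr_def Hom_def minus_zero)
  then have "(idn T y, zero_arr T y (shift_ob T Z), uminus_arr T (shift_arr T (zero_arr T Z y))) \<in> dist T"
    using TR1_idn[OF assms(2) S] by simp
  moreover have "triangle T (zero_arr T Z y, idn T y, zero_arr T y (shift_ob T Z))"
    using zero_Hom[OF ob(1) assms(2)] zero_Hom[OF assms(2) ob(2)] idn_Hom[OF assms(2)]
    by (simp add: triangle_def Hom_def)
  ultimately show ?thesis
    by (simp add: TR2)
qed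

text \<open>TR3 compares the triangle with the one on \<open>Z\<close>, \<open>w\<close>,
  \<open>w\<close> from \<open>zero_idn_dist\<close>: the first square commutes because
  \<open>b \<cdot> f\<close> vanishes, and the third component is the desired
  \<open>c\<close>.\<close>

lemma dist_weak_cokernel:
  assumes "(f, g, h) \<in> dist T" "f \<in> Hom T x y" "g \<in> Hom T y z"
    and "b \<in> Hom T y w" "b \<cdot> f = zero_arr T x w"
  shows "\<exists>c \<in> Hom T z w. c \<cdot> g = b"
proof -
  obtain Z where Z: "zero_object T Z"
    using ex_zero_object by blast
  have ob: "x \<in> ob T" "Z \<in> ob T" "w \<in> ob T"
    using Hom_ob assms zero_objectD(1)[OF Z] by blast+
  have 0: "zero_arr T x Z \<in> Hom T x Z" "zero_arr T Z w \<in> Hom T Z w"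
    using ob by (simp_all add: zero_Hom)
  have "b \<cdot> f = zero_arr T Z w \<cdot> zero_arr T x Z"
    using zero_cmp[OF 0(1) ob(3)] assms(5) by simp
  then obtain c where "triangle_morphism T (f, g, h)
      (zero_arr T Z w, idn T w, zero_arr T w (shift_ob T Z)) (zero_arr T x Z) b c"
    using TR3[OF assms(1) zero_idn_dist[OF Z ob(3)], of "zero_arr T x Z" b] assms(2-4) 0
      idn_Hom[OF ob(3)] by (auto simp: Hom_def)
  moreover have "src T h = z"
    using dist_triangle[OF assms(1)] assms(3) by (auto simp: triangle_def Hom_def)
  moreover have "src T (zero_arr T w (shift_ob T Z)) = w"
    using dist_triangle[OF zero_idn_dist[OF Z ob(3)]] idn_Hom[OF ob(3)]
    by (auto simp: triangle_def Hom_def)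
  ultimately show ?thesis
    using idn_cmp[OF assms(4)] by (auto simp: triangle_morphism_def)
qed

text \<open>The cone of a split monomorphism is a complement: the connecting arrow vanishes, so
  \<open>g\<close> is epimorphic, and \<open>idn T y\<close> minus \<open>i \<cdot> r\<close> kills
  \<open>i\<close>, so it factors through \<open>g\<close> and yields the section \<open>s\<close>.
  The triangle is returned along with the biproduct so that two-of-three can be applied to
  it.\<close>

lemma split_mono_cone:
  assumes i: "i \<in> Hom T x y" and r: "r \<in> Hom T y x" and ri: "r \<cdot> i = idn T x"
  obtains z g h s where "(i, g, h) \<in> dist T" "g \<in> Hom T y z" "h \<in> Hom T z (shift_ob T x)"
    "biproduct T x z y i s r g"
proof -
  obtain g h where d: "(i, g, h) \<in> dist T"
    using TR1_cone[of i] i by (auto simp: Hom_def)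
  obtain z where g: "g \<in> Hom T y z" and h: "h \<in> Hom T z (shift_ob T x)" and z: "z \<in> ob T"
    using dist_objects[OF d i] .
  have ob: "x \<in> ob T" "y \<in> ob T"
    using Hom_ob[OF i] .
  have h0: "h = zero_arr T z (shift_ob T x)"
    by (rule dist_split_mono[OF d i h r ri])
  have gi: "g \<cdot> i = zero_arr T x z"
    by (rule dist_cmp_zero[OF d i g])
  \<comment> \<open>After rotation \<open>h\<close> is a weak cokernel of \<open>g\<close>. An arrow
    killing \<open>g\<close> then factors through \<open>h\<close>, which is zero; hence
    \<open>g\<close> is epimorphic.\<close>
  have d': "(g, h, uminus_arr T (shift_arr T i)) \<in> dist T"
    using TR2[OF dist_triangle[OF d]] d by simp
  have epi: "b = zero_arr T z w" if b: "b \<in> Hom T z w" "b \<cdot> g = zero_arr T y w" for b w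
  proof -
    obtain c where c: "c \<in> Hom T (shift_ob T x) w" "c \<cdot> h = b"
      using dist_weak_cokernel[OF d' g h b] by blast
    then show ?thesis
      using cmp_zero[OF c(1) z] h0 by simp
  qed
  have ir: "i \<cdot> r \<in> Hom T y y" and idy: "idn T y \<in> Hom T y y"
    using i r ob by (auto intro: cmp_Hom idn_Hom)
  \<comment> \<open>Here \<open>n\<close> is \<open>idn T y\<close> minus
    \<open>i \<cdot> r\<close>, the idempotent onto the complement.\<close>
  obtain n where n: "n \<in> Hom T y y" "i \<cdot> r \<boxplus> n = idn T y"
    using ex_minus[OF ob(2) ob(2) ir idy] by blast
  have iri: "(i \<cdot> r) \<cdot> i = i"
    using cmp_assoc[OF i r i] ri cmp_idn[OF i] by simp
  have "i \<boxplus> n \<cdot> i = i \<boxplus> zero_arr T x y"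
    using cmp_plus[OF i ir n(1)] n(2) iri idn_cmp[OF i] ob by (simp add: plus_zero[OF _ _ i])
  then have "n \<cdot> i = zero_arr T x y"
    using plus_left_cancel[OF i cmp_Hom[OF i n(1)] zero_Hom[OF ob]] by simp
  then obtain s where s: "s \<in> Hom T z y" "s \<cdot> g = n"
    using dist_weak_cokernel[OF d i g n(1)] by blast
  have gir: "g \<cdot> (i \<cdot> r) = zero_arr T y z"
    using cmp_assoc[OF r i g] gi zero_cmp[OF r z] by simp
  have gn: "g \<cdot> n = g"
    using plus_cmp[OF ir n(1) g] n(2) gir cmp_idn[OF g] zero_plus[OF ob(2) z cmp_Hom[OF n(1) g]]
    by simp
  have gs: "g \<cdot> s = idn T z"
  proof -
    have idz: "idn T z \<in> Hom T z z"
      using z by (rule idn_Hom)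
    have gs': "g \<cdot> s \<in> Hom T z z"
      using cmp_Hom[OF s(1) g] .
    \<comment> \<open>The difference \<open>b\<close> of \<open>g \<cdot> s\<close> and the identity
      satisfies \<open>b \<cdot> g = 0\<close>, because
      \<open>g \<cdot> s \<cdot> g = g \<cdot> n = g\<close>; then \<open>epi\<close>
      applies.\<close>
    obtain b where b: "b \<in> Hom T z z" "idn T z \<boxplus> b = g \<cdot> s"
      using ex_minus[OF z z idz gs'] by blast
    have "g \<boxplus> b \<cdot> g = g \<boxplus> zero_arr T y z"
      using cmp_plus[OF g idz b(1)] b(2) cmp_assoc[OF g s(1) g] s(2) gn idn_cmp[OF g]
        plus_zero[OF ob(2) z g] by simp
    then have "b \<cdot> g = zero_arr T y z"
      using plus_left_cancel[OF g cmp_Hom[OF g b(1)] zero_Hom[OF ob(2) z]] by simp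
    then have "b = zero_arr T z z"
      by (rule epi[OF b(1)])
    then show ?thesis
      using b(2) plus_zero[OF z z idz] by simp
  qed
  have rs: "r \<cdot> s = zero_arr T z x"
  proof (rule epi)
    show "r \<cdot> s \<in> Hom T z x"
      using cmp_Hom[OF s(1) r] .
    have "r \<boxplus> r \<cdot> n = r \<boxplus> zero_arr T y x"
      using plus_cmp[OF ir n(1) r] n(2) cmp_assoc[OF r i r] ri idn_cmp[OF r] cmp_idn[OF r]
        plus_zero[OF ob(2,1) r] by simp
    then have "r \<cdot> n = zero_arr T y x"
      using plus_left_cancel[OF r cmp_Hom[OF n(1) r] zero_Hom[OF ob(2,1)]] by simp
    then show "(r \<cdot> s) \<cdot> g = zero_arr T y x"
      using cmp_assoc[OF g s(1) r] s(2) by simp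
  qed
  have "biproduct T x z y i s r g"
    using ob z i s r g ri gs rs gi n(2) by (auto simp: biproduct_def)
  with d g h show thesis
    by (rule that)
qed

text \<open>Closure under summands is phrased through biproducts, whereas later arguments only
  produce a section and a retraction. The cone supplies the missing complement.\<close>

lemma thick_retract:
  assumes "thick_subcategory T S" "i \<in> Hom T x y" "r \<in> Hom T y x" "r \<cdot> i = idn T x" "y \<in> S"
  shows "x \<in> S"
proof -
  have "direct_summand T x y"
    using split_mono_cone[OF assms(2-4)] by (metis direct_summand_def)
  then show ?thesis
    using thick_direct_summand[OF assms(1)] assms(5) by blast
qed

lemma thick_isomorphic:
  assumes "thick_subcategory T S" "isomorphic T x y"
  shows "x \<in> S \<longleftrightarrow> y \<in> S"
proof -
  obtain f g where fg: "f \<in> Hom T x y" "g \<in> Hom T y x" "g \<cdot> f = idn T x" "f \<cdot> g = idn T y"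
    using isomorphicE[OF assms(2)] .
  show ?thesis
    using thick_retract[OF assms(1) fg(1,2,3)] thick_retract[OF assms(1) fg(2,1,4)] by blast
qed

text \<open>The cone of the injection of \<open>x\<close> is a retract of the complementary summand \<open>y\<close>.\<close>

lemma thick_biproduct:
  assumes S: "thick_subcategory T S" and bip: "biproduct T x y z i j p q"
  shows "z \<in> S \<longleftrightarrow> x \<in> S \<and> y \<in> S"
proof
  have ij: "i \<in> Hom T x z" "p \<in> Hom T z x" "p \<cdot> i = idn T x"
      "j \<in> Hom T y z" "q \<in> Hom T z y" "q \<cdot> j = idn T y"
    using bip by (auto simp: biproduct_def)
  assume "z \<in> S"
  then show "x \<in> S \<and> y \<in> S"
    using thick_retract[OF S ij(1,2,3)] thick_retract[OF S ij(4,5,6)] by blast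
next
  assume xy: "x \<in> S \<and> y \<in> S"
  have b: "i \<in> Hom T x z" "j \<in> Hom T y z" "p \<in> Hom T z x" "q \<in> Hom T z y"
      "p \<cdot> i = idn T x" "i \<cdot> p \<boxplus> j \<cdot> q = idn T z"
    using bip by (auto simp: biproduct_def)
  obtain c g h s where d: "(i, g, h) \<in> dist T" and g: "g \<in> Hom T z c"
    and h: "h \<in> Hom T c (shift_ob T x)" and c: "biproduct T x c z i s p g"
    using split_mono_cone[OF b(1,3,5)] .
  have s: "s \<in> Hom T c z" "g \<cdot> s = idn T c" "i \<cdot> p \<boxplus> s \<cdot> g = idn T z"
    using c by (auto simp: biproduct_def)
  have ip: "i \<cdot> p \<in> Hom T z z" and jq: "j \<cdot> q \<in> Hom T z z" and sg: "s \<cdot> g \<in> Hom T z z"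
    using b s g by (auto intro: cmp_Hom)
  \<comment> \<open>Both are the identity minus \<open>i \<cdot> p\<close>, since the two biproducts
    share \<open>i\<close> and \<open>p\<close>. Hence \<open>q \<cdot> s\<close> from
    \<open>c\<close> to \<open>y\<close> is split by \<open>g \<cdot> j\<close>.\<close>
  have "j \<cdot> q = s \<cdot> g"
    using plus_left_cancel[OF ip jq sg] b(6) s(3) by simp
  then have "(g \<cdot> j) \<cdot> (q \<cdot> s) = g \<cdot> ((s \<cdot> g) \<cdot> s)"
    using cmp_assoc[OF s(1) b(4,2)] cmp_assoc[OF cmp_Hom[OF s(1) b(4)] b(2) g] by simp
  also have "\<dots> = idn T c"
    using cmp_assoc[OF s(1) g s(1)] s(2) cmp_idn[OF s(1)] by simp
  finally have "c \<in> S"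
    using thick_retract[OF S cmp_Hom[OF s(1) b(4)] cmp_Hom[OF b(2) g]] xy by simp
  moreover have "src T i = x" "src T g = z" "src T h = c"
    using b(1) g h by (auto simp: Hom_def)
  ultimately show "z \<in> S"
    using thick_dist2[OF S d] xy by simp
qed

lemma thick_ob: "thick_subcategory T (ob T)"
proof -
  have F: "is_functor T T (shift_ob T) (shift_arr T)"
    using shift_additive by (simp add: additive_functor_def)
  have "src T f \<in> ob T" "src T g \<in> ob T" "src T h \<in> ob T" if "(f, g, h) \<in> dist T" for f g h
    using dist_triangle[OF that] src_ob by (auto simp: triangle_def)
  then show ?thesis
    using is_functorD(1)[OF F]
    by (intro thick_subcategoryI) (auto simp: direct_summand_def biproduct_def zero_object_def)
qed

end

text \<open>The shift condition transfers along the isomorphisms \<open>\<phi>\<close>, two-of-three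
  along the image triangles, and summands along the image biproducts.\<close>

lemma exact_preimage_thick:
  assumes "triangulated_category S" "triangulated_category T" "exact_functor S T Fo Fa"
    and P: "thick_subcategory T P"
  shows "thick_subcategory S {x \<in> ob S. Fo x \<in> P}"
proof -
  interpret S: triangulated_category S by fact
  interpret T: triangulated_category T by fact
  have add: "additive_category S" "additive_category T" ..
  have Fadd: "additive_functor S T Fo Fa"
    using assms(3) by (simp add: exact_functor_def)
  have F: "is_functor S T Fo Fa"
    using Fadd by (simp add: additive_functor_def)
  obtain \<phi> where nat: "natural_iso S T (\<lambda>x. Fo (shift_ob S x)) (\<lambda>f. Fa (shift_arr S f))
            (\<lambda>x. shift_ob T (Fo x)) (\<lambda>f. shift_arr T (Fa f)) \<phi>"
    and dist: "\<And>f g h. (f, g, h) \<in> dist S \<Longrightarrow> (Fa f, Fa g, \<phi> (src S f) \<cdot>\<^bsub>T\<^esub> Fa h) \<in> dist T"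
    using assms(3) by (auto simp: exact_functor_def)
  have \<phi>: "\<phi> x \<in> Hom T (Fo (shift_ob S x)) (shift_ob T (Fo x))" "iso_arr T (\<phi> x)"
    if "x \<in> ob S" for x
    using nat that by (auto simp: natural_iso_def)
  show ?thesis
  proof (rule thick_subcategoryI)
    show "z \<in> {x \<in> ob S. Fo x \<in> P}" if "zero_object S z" for z
      using thick_zero_object[OF P additive_functor_zero_object[OF add Fadd that]]
        S.zero_objectD(1)[OF that] by simp
    show "x \<in> {x \<in> ob S. Fo x \<in> P} \<longleftrightarrow> shift_ob S x \<in> {x \<in> ob S. Fo x \<in> P}" if "x \<in> ob S" for x
    proof -
      have "isomorphic T (Fo (shift_ob S x)) (shift_ob T (Fo x))"
        using \<phi>[OF that] by (auto simp: isomorphic_def)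
      then have "Fo (shift_ob S x) \<in> P \<longleftrightarrow> shift_ob T (Fo x) \<in> P"
        by (rule T.thick_isomorphic[OF P])
      also have "\<dots> \<longleftrightarrow> Fo x \<in> P"
        using thick_shift[OF P is_functorD(1)[OF F that]] .
      finally show ?thesis
        using thick_shift[OF S.thick_ob that] that by auto
    qed
  next
    fix f g h assume d: "(f, g, h) \<in> dist S"
    have tr: "f \<in> arr S" "g \<in> arr S" "h \<in> arr S" "tgt S h = shift_ob S (src S f)"
      using S.dist_triangle[OF d] by (auto simp: triangle_def)
    have Hom: "f \<in> Hom S (src S f) (tgt S f)" "g \<in> Hom S (src S g) (tgt S g)"
        "h \<in> Hom S (src S h) (shift_ob S (src S f))"
      using tr by (auto simp: Hom_def)
    have ob: "src S f \<in> ob S" "src S g \<in> ob S" "src S h \<in> ob S"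
      using tr S.src_ob by auto
    \<comment> \<open>Correcting the third arrow by \<open>\<phi>\<close> leaves its source
      unchanged, so the objects of the image triangle are the images of the original
      objects.\<close>
    have "\<phi> (src S f) \<cdot>\<^bsub>T\<^esub> Fa h \<in> Hom T (Fo (src S h)) (shift_ob T (Fo (src S f)))"
      using T.cmp_Hom[OF is_functorD(3)[OF F Hom(3)] \<phi>(1)[OF ob(1)]] .
    then have src: "src T (Fa f) = Fo (src S f)" "src T (Fa g) = Fo (src S g)"
        "src T (\<phi> (src S f) \<cdot>\<^bsub>T\<^esub> Fa h) = Fo (src S h)"
      using is_functorD(3)[OF F Hom(1)] is_functorD(3)[OF F Hom(2)] by (auto simp: Hom_def)
    note two_of_three = thick_dist1[OF P dist[OF d]] thick_dist2[OF P dist[OF d]]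
      thick_dist3[OF P dist[OF d]]
    show "src S h \<in> {x \<in> ob S. Fo x \<in> P}"
      if "src S f \<in> {x \<in> ob S. Fo x \<in> P}" "src S g \<in> {x \<in> ob S. Fo x \<in> P}"
      using that two_of_three ob by (simp add: src)
    show "src S f \<in> {x \<in> ob S. Fo x \<in> P}"
      if "src S g \<in> {x \<in> ob S. Fo x \<in> P}" "src S h \<in> {x \<in> ob S. Fo x \<in> P}"
      using that two_of_three ob by (simp add: src)
    show "src S g \<in> {x \<in> ob S. Fo x \<in> P}"
      if "src S f \<in> {x \<in> ob S. Fo x \<in> P}" "src S h \<in> {x \<in> ob S. Fo x \<in> P}"
      using that two_of_three ob by (simp add: src)
  next
    fix x z assume "direct_summand S x z" "z \<in> {x \<in> ob S. Fo x \<in> P}"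
    then obtain y i j p q where b: "biproduct S x y z i j p q" "Fo z \<in> P"
      by (auto simp: direct_summand_def)
    then show "x \<in> {x \<in> ob S. Fo x \<in> P}"
      using T.thick_biproduct[OF P additive_functor_biproduct[OF add Fadd b(1)]]
      by (simp add: biproduct_def)
  qed auto
qed


section \<open>Tensor preimages, generated ideals and finiteness of generation\<close>

section \<open>Thick ideals\<close>

context monoidal_triangulated_category
begin

lemma tensor_additive:
  assumes "w \<in> ob K"
  shows "additive_functor K K (\<lambda>x. w \<odot> x) (\<lambda>f. idn K w \<star> f)"
    and "additive_functor K K (\<lambda>x. x \<odot> w) (\<lambda>f. f \<star> idn K w)"
  using tensor_left_exact[OF assms] tensor_right_exact[OF assms] by (auto simp: exact_functor_def)

lemma tensor_isomorphic:
  assumes "w \<in> ob K" "isomorphic K x y"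
  shows "isomorphic K (w \<odot> x) (w \<odot> y)" "isomorphic K (x \<odot> w) (y \<odot> w)"
proof -
  have c: "category K" ..
  show "isomorphic K (w \<odot> x) (w \<odot> y)"
    using functor_isomorphic[OF c c _ assms(2)] tensor_additive(1)[OF assms(1)]
    unfolding additive_functor_def by blast
  show "isomorphic K (x \<odot> w) (y \<odot> w)"
    using functor_isomorphic[OF c c _ assms(2)] tensor_additive(2)[OF assms(1)]
    unfolding additive_functor_def by blast
qed

lemma associator_isomorphic:
  assumes "x \<in> ob K" "y \<in> ob K" "z \<in> ob K"
  shows "isomorphic K ((x \<odot> y) \<odot> z) (x \<odot> (y \<odot> z))"
  using associator_Hom[OF assms] associator_iso[OF assms] by (auto simp: isomorphic_def)

lemma runitor_isomorphic:
  assumes "x \<in> ob K"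
  shows "isomorphic K (x \<odot> unit_ob K) x"
  using runitor_Hom[OF assms] runitor_iso[OF assms] by (auto simp: isomorphic_def)

text \<open>This is exactness of the tensor product in each variable. Conditions with several tensor
  factors are treated by iterating it.\<close>

lemma tensor_preimage_thick:
  assumes "thick_subcategory K P" "w \<in> ob K"
  shows "thick_subcategory K {x \<in> ob K. w \<odot> x \<in> P}"
    and "thick_subcategory K {x \<in> ob K. x \<odot> w \<in> P}"
proof -
  have t: "triangulated_category K" ..
  show "thick_subcategory K {x \<in> ob K. w \<odot> x \<in> P}"
    using exact_preimage_thick[OF t t tensor_left_exact[OF assms(2)] assms(1)] .
  show "thick_subcategory K {x \<in> ob K. x \<odot> w \<in> P}"
    using exact_preimage_thick[OF t t tensor_right_exact[OF assms(2)] assms(1)] .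
qed

lemma thick_ideal_ob: "thick_ideal K (ob K)"
  using thick_ob tensor_ob by (auto simp: thick_ideal_def)

lemma thick_ideal_subset: "thick_ideal K J \<Longrightarrow> J \<subseteq> ob K"
  by (auto simp: thick_ideal_def thick_subcategory_def)

lemma thick_ideal_thick: "thick_ideal K J \<Longrightarrow> thick_subcategory K J"
  by (simp add: thick_ideal_def)

lemma thick_ideal_Inter:
  assumes "\<And>J. J \<in> \<J> \<Longrightarrow> thick_ideal K J"
  shows "thick_ideal K (ob K \<inter> \<Inter>\<J>)"
  using assms thick_subcategory_Inter[OF thick_ob, of \<J>] tensor_ob
  by (auto simp: thick_ideal_def)

text \<open>The hypothesis puts \<open>ob K\<close> into the defining family; the intersection of an
  empty family would be \<open>UNIV\<close>.\<close>

lemma ideal_generated_thick_ideal: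
  assumes "X \<subseteq> ob K"
  shows "thick_ideal K (ideal_generated K X)"
proof -
  have "ideal_generated K X = ob K \<inter> \<Inter>{J. thick_ideal K J \<and> X \<subseteq> J}"
    using thick_ideal_ob assms by (auto simp: ideal_generated_def)
  then show ?thesis
    using thick_ideal_Inter[of "{J. thick_ideal K J \<and> X \<subseteq> J}"] by simp
qed

lemma ideal_generated_superset: "X \<subseteq> ideal_generated K X"
  by (auto simp: ideal_generated_def)

lemma ideal_generated_least: "\<lbrakk>thick_ideal K J; X \<subseteq> J\<rbrakk> \<Longrightarrow> ideal_generated K X \<subseteq> J"
  by (auto simp: ideal_generated_def)

lemma ideal_generated_mono: "X \<subseteq> Y \<Longrightarrow> ideal_generated K X \<subseteq> ideal_generated K Y"
  by (auto simp: ideal_generated_def)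

lemma ideal_generated_eqI:
  assumes "\<And>J. thick_ideal K J \<Longrightarrow> X \<subseteq> J \<longleftrightarrow> Y \<subseteq> J"
  shows "ideal_generated K X = ideal_generated K Y"
  using assms by (auto simp: ideal_generated_def)

lemma semiprime_thick_ideal: "semiprime_ideal K J \<Longrightarrow> thick_ideal K J"
  using thick_ideal_Inter by (auto simp: semiprime_ideal_def prime_ideal_def)

text \<open>Each closure condition of a thick ideal starts from at most two members, so the directed
  union \<open>U\<close> of the ideals generated by finite subsets is again a thick ideal. It
  contains \<open>X\<close>, hence the whole ideal generated by \<open>X\<close>.\<close>

lemma ideal_generated_finite:
  assumes "X \<subseteq> ob K" "x \<in> ideal_generated K X"
  obtains X\<^sub>0 where "finite X\<^sub>0" "X\<^sub>0 \<subseteq> X" "x \<in> ideal_generated K X\<^sub>0"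
proof -
  define \<F> where "\<F> = {X\<^sub>0. finite X\<^sub>0 \<and> X\<^sub>0 \<subseteq> X}"
  define U where "U = (\<Union>X\<^sub>0 \<in> \<F>. ideal_generated K X\<^sub>0)"
  have id: "thick_ideal K (ideal_generated K Y)" if "Y \<in> \<F>" for Y
    using that assms(1) by (intro ideal_generated_thick_ideal) (auto simp: \<F>_def)
  note th = thick_ideal_thick[OF id]
  \<comment> \<open>The ideal of the empty subset puts the zero objects into \<open>U\<close>, even
    when \<open>X\<close> itself is empty.\<close>
  have empty: "{} \<in> \<F>"
    by (simp add: \<F>_def)
  have directed: "\<exists>Y \<in> \<F>. x \<in> ideal_generated K Y \<and> y \<in> ideal_generated K Y"
    if xy: "x \<in> U" "y \<in> U" for x y
  proof -
    obtain Y Z where YZ: "Y \<in> \<F>" "x \<in> ideal_generated K Y" "Z \<in> \<F>" "y \<in> ideal_generated K Z"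
      using xy by (auto simp: U_def)
    moreover have "Y \<union> Z \<in> \<F>"
      using YZ by (auto simp: \<F>_def)
    ultimately show ?thesis
      using ideal_generated_mono[of Y "Y \<union> Z"] ideal_generated_mono[of Z "Y \<union> Z"] by blast
  qed
  have U_I: "y \<in> U" if "Y \<in> \<F>" "y \<in> ideal_generated K Y" for y Y
    using that by (auto simp: U_def)
  have "thick_subcategory K U"
  proof (rule thick_subcategoryI)
    show "U \<subseteq> ob K"
      using th[THEN thick_subset] by (auto simp: U_def)
    show "z \<in> U" if "zero_object K z" for z
      using U_I[OF empty thick_zero_object[OF th[OF empty] that]] .
    show "x \<in> U \<longleftrightarrow> shift_ob K x \<in> U" if "x \<in> ob K" for x
      using thick_shift[OF th that] by (auto simp: U_def)
    show "x \<in> U" if "direct_summand K x z" "z \<in> U" for x z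
      using that thick_direct_summand[OF th] unfolding U_def by blast
  next
    fix f g h assume d: "(f, g, h) \<in> dist K"
    show "src K h \<in> U" if "src K f \<in> U" "src K g \<in> U"
      using directed[OF that] thick_dist3[OF th d] U_I by blast
    show "src K f \<in> U" if "src K g \<in> U" "src K h \<in> U"
      using directed[OF that] thick_dist1[OF th d] U_I by blast
    show "src K g \<in> U" if "src K f \<in> U" "src K h \<in> U"
      using directed[OF that] thick_dist2[OF th d] U_I by blast
  qed
  moreover have "\<forall>x \<in> U. \<forall>y \<in> ob K. x \<odot> y \<in> U \<and> y \<odot> x \<in> U"
    using id unfolding thick_ideal_def U_def by blast
  ultimately have "thick_ideal K U"
    by (simp add: thick_ideal_def)
  moreover have "X \<subseteq> U"
  proof
    fix y assume "y \<in> X"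
    then have "{y} \<in> \<F>"
      by (simp add: \<F>_def)
    then show "y \<in> U"
      using ideal_generated_superset[of "{y}"] by (intro U_I) auto
  qed
  ultimately have "x \<in> U"
    using ideal_generated_least assms(2) by blast
  then show thesis
    using that by (auto simp: U_def \<F>_def)
qed


section \<open>Replacing many generators by a single centralizing object\<close>

section \<open>Central generators\<close>

lemma centralizes_zero_object:
  assumes "zero_object K z" "I \<subseteq> ob K"
  shows "centralizes K z I"
  unfolding centralizes_def
proof
  fix w assume "w \<in> I"
  then have w: "w \<in> ob K"
    using assms(2) by blast
  have add: "additive_category K" ..
  show "isomorphic K (z \<odot> w) (w \<odot> z)"
    using zero_objects_isomorphic additive_functor_zero_object[OF add add _ assms(1)]
      tensor_additive[OF w] by blast
qed

text \<open>Tensoring with \<open>w\<close> on either side preserves the biproduct, and the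
  isomorphisms chosen separately for the two summands assemble into one for
  \<open>z\<close>.\<close>

lemma centralizes_biproduct:
  assumes "biproduct K x y z i j p q" "centralizes K x I" "centralizes K y I" "I \<subseteq> ob K"
  shows "centralizes K z I"
  unfolding centralizes_def
proof
  fix w assume wI: "w \<in> I"
  then have w: "w \<in> ob K"
    using assms(4) by blast
  have add: "additive_category K" ..
  show "isomorphic K (z \<odot> w) (w \<odot> z)"
    using biproduct_isomorphic[OF additive_functor_biproduct[OF add add tensor_additive(2)[OF w] assms(1)]
        additive_functor_biproduct[OF add add tensor_additive(1)[OF w] assms(1)]]
      assms(2,3) wI by (simp add: centralizes_def)
qed

text \<open>A thick ideal contains a biproduct exactly when it contains both summands, so summing
  the generators keeps the ideal. The empty set is represented by a zero object.\<close>

lemma finite_central_generator: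
  assumes "finite X" "X \<subseteq> ob K" "\<And>x. x \<in> X \<Longrightarrow> centralizes K x I" "I \<subseteq> ob K"
  shows "\<exists>z \<in> ob K. centralizes K z I \<and> ideal_generated K {z} = ideal_generated K X"
  using assms(1-3)
proof (induction X rule: finite_induct)
  case empty
  obtain z where z: "zero_object K z"
    using ex_zero_object by blast
  have "ideal_generated K {z} = ideal_generated K {}"
    by (rule ideal_generated_eqI) (use z in \<open>auto simp: thick_ideal_def thick_subcategory_def\<close>)
  then show ?case
    using z centralizes_zero_object[OF z assms(4)] zero_objectD(1) by blast
next
  case (insert x X)
  then obtain y where y: "y \<in> ob K" "centralizes K y I" "ideal_generated K {y} = ideal_generated K X"
    by auto
  have x: "x \<in> ob K" "centralizes K x I"
    using insert.prems by auto
  obtain z i j p q where z: "biproduct K x y z i j p q"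
    using ex_biproduct[OF x(1) y(1)] by blast
  have "{z} \<subseteq> J \<longleftrightarrow> insert x X \<subseteq> J" if J: "thick_ideal K J" for J
  proof -
    have "y \<in> J \<longleftrightarrow> X \<subseteq> J"
      using ideal_generated_least[OF J, of X] ideal_generated_least[OF J, of "{y}"]
        ideal_generated_superset[of X] ideal_generated_superset[of "{y}"] y(3) by auto
    then show ?thesis
      using thick_biproduct[OF thick_ideal_thick[OF J] z] by simp
  qed
  then have "ideal_generated K {z} = ideal_generated K (insert x X)"
    by (rule ideal_generated_eqI)
  moreover have "z \<in> ob K"
    using z by (simp add: biproduct_def)
  ultimately show ?case
    using centralizes_biproduct[OF z x(2) y(2) assms(4)] by blast
qed

text \<open>Since \<open>x\<close> already lies in the ideal of a finite \<open>X\<^sub>0\<close>,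
  that ideal is squeezed between the ideal of \<open>x\<close> and the ideal of \<open>X\<close>,
  which coincide.\<close>

lemma central_generator:
  assumes "weak_central_generation K I" "x \<in> ob K"
  obtains z where "z \<in> ob K" "centralizes K z I" "ideal_generated K {z} = ideal_generated K {x}"
proof -
  have I: "I \<subseteq> ob K"
    using assms(1) by (simp add: weak_central_generation_def)
  have "thick_ideal K (ideal_generated K {x})"
    using assms(2) by (intro ideal_generated_thick_ideal) simp
  then obtain X where X: "X \<subseteq> ob K" "\<forall>x \<in> X. centralizes K x I"
    "ideal_generated K {x} = ideal_generated K X"
    using assms(1) unfolding weak_central_generation_def by metis
  have "x \<in> ideal_generated K X"
    using ideal_generated_superset[of "{x}"] X(3) by auto
  then obtain X\<^sub>0 where X\<^sub>0: "finite X\<^sub>0" "X\<^sub>0 \<subseteq> X" "x \<in> ideal_generated K X\<^sub>0"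
    using ideal_generated_finite[OF X(1)] by blast
  have "X\<^sub>0 \<subseteq> ob K"
    using X X\<^sub>0 by blast
  then have "ideal_generated K {x} \<subseteq> ideal_generated K X\<^sub>0"
    using X\<^sub>0(3) by (intro ideal_generated_least ideal_generated_thick_ideal) auto
  moreover have "ideal_generated K X\<^sub>0 \<subseteq> ideal_generated K {x}"
    using ideal_generated_mono[OF X\<^sub>0(2)] X(3) by simp
  ultimately have "ideal_generated K X\<^sub>0 = ideal_generated K {x}"
    by blast
  moreover obtain z where "z \<in> ob K" "centralizes K z I" "ideal_generated K {z} = ideal_generated K X\<^sub>0"
    using finite_central_generator[OF X\<^sub>0(1) \<open>X\<^sub>0 \<subseteq> ob K\<close> _ I] X(2) X\<^sub>0(2) by blast
  ultimately show thesis
    using that by simp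
qed


section \<open>Objectwise primality and semiprime closures\<close>

section \<open>Prime ideals\<close>

text \<open>The middle factor \<open>k\<close> makes the annihilator two-sided: multiplying
  \<open>a\<close> on the right by \<open>c\<close> only replaces \<open>k\<close> by
  \<open>c \<odot> k\<close>, while multiplying on the left is absorbed by \<open>P\<close>.\<close>

lemma left_annihilator_thick_ideal:
  assumes P: "thick_ideal K P" and B: "B \<subseteq> ob K"
  shows "thick_ideal K {a \<in> ob K. \<forall>b \<in> B. \<forall>k \<in> ob K. (a \<odot> k) \<odot> b \<in> P}" (is "thick_ideal K ?L")
proof -
  \<comment> \<open>Each member is an iterated preimage of \<open>P\<close>, under tensoring on the
    right with \<open>k\<close> and then with \<open>b\<close>.\<close>
  define \<S> where "\<S> = (\<lambda>(k, b). {a \<in> ob K. a \<odot> k \<in> {c \<in> ob K. c \<odot> b \<in> P}}) ` (ob K \<times> B)"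
  note iso = thick_isomorphic[OF thick_ideal_thick[OF P]]
  have "?L = ob K \<inter> \<Inter>\<S>"
    using tensor_ob by (auto simp: \<S>_def)
  moreover have "thick_subcategory K S" if "S \<in> \<S>" for S
    using that B tensor_preimage_thick(2) thick_ideal_thick[OF P] by (auto simp only: \<S>_def)
  ultimately have "thick_subcategory K ?L"
    using thick_subcategory_Inter[OF thick_ob] by simp
  moreover have "a \<odot> c \<in> ?L \<and> c \<odot> a \<in> ?L" if a: "a \<in> ?L" and c: "c \<in> ob K" for a c
  proof -
    have "((a \<odot> c) \<odot> k) \<odot> b \<in> P" "((c \<odot> a) \<odot> k) \<odot> b \<in> P" if b: "b \<in> B" and k: "k \<in> ob K" for b k
    proof -
      have ob: "a \<in> ob K" "b \<in> ob K" "a \<odot> k \<in> ob K"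
        using a b k B tensor_ob by auto
      have "isomorphic K (((a \<odot> c) \<odot> k) \<odot> b) ((a \<odot> (c \<odot> k)) \<odot> b)"
        using ob c k by (intro tensor_isomorphic associator_isomorphic)
      then show "((a \<odot> c) \<odot> k) \<odot> b \<in> P"
        using a b c k tensor_ob iso by blast
      have "(a \<odot> k) \<odot> b \<in> P"
        using a b k by blast
      then have "c \<odot> ((a \<odot> k) \<odot> b) \<in> P"
        using P c by (simp add: thick_ideal_def)
      then have "(c \<odot> (a \<odot> k)) \<odot> b \<in> P"
        using iso[OF associator_isomorphic[OF c ob(3,2)]] by simp
      moreover have "isomorphic K (((c \<odot> a) \<odot> k) \<odot> b) ((c \<odot> (a \<odot> k)) \<odot> b)"
        using ob c k by (intro tensor_isomorphic associator_isomorphic)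
      ultimately show "((c \<odot> a) \<odot> k) \<odot> b \<in> P"
        using iso by blast
    qed
    then show ?thesis
      using a c tensor_ob by blast
  qed
  ultimately show ?thesis
    by (simp only: thick_ideal_def) blast
qed

text \<open>Dually, multiplying \<open>b\<close> on the right is absorbed by \<open>P\<close>, and
  multiplying it on the left by \<open>c\<close> replaces \<open>k\<close> by
  \<open>k \<odot> c\<close>.\<close>

lemma right_annihilator_thick_ideal:
  assumes P: "thick_ideal K P" and A: "A \<subseteq> ob K"
  shows "thick_ideal K {b \<in> ob K. \<forall>a \<in> A. \<forall>k \<in> ob K. (a \<odot> k) \<odot> b \<in> P}" (is "thick_ideal K ?R")
proof -
  define \<S> where "\<S> = (\<lambda>(k, a). {b \<in> ob K. (a \<odot> k) \<odot> b \<in> P}) ` (ob K \<times> A)"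
  note iso = thick_isomorphic[OF thick_ideal_thick[OF P]]
  have "?R = ob K \<inter> \<Inter>\<S>"
    by (auto simp: \<S>_def)
  moreover have "thick_subcategory K S" if S: "S \<in> \<S>" for S
  proof -
    obtain k a where "k \<in> ob K" "a \<in> A" "S = {b \<in> ob K. (a \<odot> k) \<odot> b \<in> P}"
      using S by (auto simp: \<S>_def)
    then show ?thesis
      using A tensor_preimage_thick(1)[OF thick_ideal_thick[OF P] tensor_ob] by blast
  qed
  ultimately have "thick_subcategory K ?R"
    using thick_subcategory_Inter[OF thick_ob] by simp
  moreover have "b \<odot> c \<in> ?R \<and> c \<odot> b \<in> ?R" if b: "b \<in> ?R" and c: "c \<in> ob K" for b c
  proof -
    have "(a \<odot> k) \<odot> (b \<odot> c) \<in> P" "(a \<odot> k) \<odot> (c \<odot> b) \<in> P" if a: "a \<in> A" and k: "k \<in> ob K" for a k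
    proof -
      have ob: "a \<in> ob K" "b \<in> ob K" "a \<odot> k \<in> ob K"
        using a b k A tensor_ob by auto
      have "((a \<odot> k) \<odot> b) \<odot> c \<in> P"
        using P a b c k by (simp add: thick_ideal_def)
      then show "(a \<odot> k) \<odot> (b \<odot> c) \<in> P"
        using iso[OF associator_isomorphic[OF ob(3,2) c]] by simp
      have "(a \<odot> (k \<odot> c)) \<odot> b \<in> P"
        using a b c k tensor_ob by blast
      moreover have "isomorphic K (((a \<odot> k) \<odot> c) \<odot> b) ((a \<odot> (k \<odot> c)) \<odot> b)"
        using ob c k by (intro tensor_isomorphic associator_isomorphic)
      ultimately have "((a \<odot> k) \<odot> c) \<odot> b \<in> P"
        using iso by blast
      then show "(a \<odot> k) \<odot> (c \<odot> b) \<in> P"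
        using iso[OF associator_isomorphic[OF ob(3) c ob(2)]] by simp
    qed
    then show ?thesis
      using b c tensor_ob by blast
  qed
  ultimately show ?thesis
    by (simp only: thick_ideal_def) blast
qed

text \<open>Primality is defined by ideals. The condition on \<open>x\<close> and \<open>y\<close>
  spreads to the ideals they generate in two stages, first on the left with \<open>y\<close> fixed,
  then on the right against the whole ideal of \<open>x\<close>.\<close>

lemma prime_idealD:
  assumes P: "prime_ideal K P" and xy: "x \<in> ob K" "y \<in> ob K"
    and "\<And>k. k \<in> ob K \<Longrightarrow> (x \<odot> k) \<odot> y \<in> P"
  shows "x \<in> P \<or> y \<in> P"
proof -
  have thP: "thick_ideal K P"
    using P by (simp add: prime_ideal_def)
  let ?X = "ideal_generated K {x}" and ?Y = "ideal_generated K {y}"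
  have X: "thick_ideal K ?X" "x \<in> ?X" and Y: "thick_ideal K ?Y" "y \<in> ?Y"
    using xy ideal_generated_thick_ideal ideal_generated_superset by auto
  have "?X \<subseteq> {a \<in> ob K. \<forall>b \<in> {y}. \<forall>k \<in> ob K. (a \<odot> k) \<odot> b \<in> P}"
    using assms by (intro ideal_generated_least left_annihilator_thick_ideal thP) auto
  then have "?Y \<subseteq> {b \<in> ob K. \<forall>a \<in> ?X. \<forall>k \<in> ob K. (a \<odot> k) \<odot> b \<in> P}"
    using xy thick_ideal_ob
    by (intro ideal_generated_least right_annihilator_thick_ideal thP) auto
  \<comment> \<open>Choosing the unit as middle factor turns the condition into one on plain
    products.\<close>
  then have k: "(a \<odot> unit_ob K) \<odot> b \<in> P" if "a \<in> ?X" "b \<in> ?Y" for a b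
    using that unit_ob by blast
  have "a \<odot> b \<in> P" if ab: "a \<in> ?X" "b \<in> ?Y" for a b
  proof -
    have "isomorphic K ((a \<odot> unit_ob K) \<odot> b) (a \<odot> b)"
      using ab thick_ideal_subset X(1) Y(1) by (intro tensor_isomorphic runitor_isomorphic) auto
    then show ?thesis
      using k[OF ab] thick_isomorphic[OF thick_ideal_thick[OF thP]] by blast
  qed
  then have "{a \<odot> b | a b. a \<in> ?X \<and> b \<in> ?Y} \<subseteq> P"
    by blast
  then show ?thesis
    using P X Y unfolding prime_ideal_def by blast
qed

text \<open>The objects \<open>k\<close> with \<open>(x \<odot> k) \<odot> y \<in> P\<close> form a thick subcategory, which contains the
  generating set because \<open>x\<close> can be moved past its elements.\<close>

lemma prime_ideal_central:
  assumes P: "prime_ideal K P" and xy: "x \<in> ob K" "y \<in> ob K"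
    and I: "I \<subseteq> ob K" "thick_generated K I = ob K" "centralizes K x I"
    and "x \<odot> y \<in> P"
  shows "x \<in> P \<or> y \<in> P"
proof (rule prime_idealD[OF P xy])
  fix k assume k: "k \<in> ob K"
  have thP: "thick_ideal K P"
    using P by (simp add: prime_ideal_def)
  note iso = thick_isomorphic[OF thick_ideal_thick[OF thP]]
  \<comment> \<open>The nested form displays the set as two successive preimages of \<open>P\<close>
    under tensor functors.\<close>
  let ?S = "{k \<in> ob K. x \<odot> k \<in> {c \<in> ob K. c \<odot> y \<in> P}}"
  have "thick_subcategory K ?S"
    using tensor_preimage_thick thick_ideal_thick[OF thP] xy by blast
  moreover have "I \<subseteq> ?S"
  proof
    fix w assume w: "w \<in> I"
    then have wob: "w \<in> ob K"
      using I by blast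
    have "w \<odot> (x \<odot> y) \<in> P"
      using assms(7) thP wob by (simp add: thick_ideal_def)
    then have "(w \<odot> x) \<odot> y \<in> P"
      using iso[OF associator_isomorphic[OF wob xy]] by simp
    moreover have "isomorphic K ((x \<odot> w) \<odot> y) ((w \<odot> x) \<odot> y)"
      using I(3) w xy by (intro tensor_isomorphic) (auto simp: centralizes_def)
    ultimately have "(x \<odot> w) \<odot> y \<in> P"
      using iso by blast
    then show "w \<in> ?S"
      using wob xy tensor_ob by simp
  qed
  ultimately have "ob K \<subseteq> ?S"
    using I(2) by (auto simp: thick_generated_def)
  then show "(x \<odot> k) \<odot> y \<in> P"
    using k by blast
qed

text \<open>Semiprime ideals are thick ideals, so whether they contain an object depends only on the
  ideal it generates. This permits passing to a centralizing generator.\<close>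

lemma semiprime_closure_cong:
  assumes "ideal_generated K {x} = ideal_generated K {y}"
  shows "semiprime_closure K x = semiprime_closure K y"
proof -
  have "x \<in> J \<longleftrightarrow> y \<in> J" if "semiprime_ideal K J" for J
    using assms semiprime_thick_ideal[OF that] ideal_generated_least[of J "{x}"]
      ideal_generated_least[of J "{y}"] ideal_generated_superset[of "{x}"]
      ideal_generated_superset[of "{y}"] by blast
  then show ?thesis
    by (auto simp: semiprime_closure_def)
qed

text \<open>The right-hand side is itself semiprime, and a semiprime ideal containing
  \<open>x\<close> is an intersection of primes that each contain \<open>x\<close>. The factor
  \<open>ob K\<close> covers the case that no prime contains \<open>x\<close>.\<close>

lemma semiprime_closure_eq:
  assumes "x \<in> ob K"
  shows "semiprime_closure K x = ob K \<inter> \<Inter>{P. prime_ideal K P \<and> x \<in> P}"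
proof (rule antisym)
  have "semiprime_ideal K (ob K \<inter> \<Inter>{P. prime_ideal K P \<and> x \<in> P})"
    unfolding semiprime_ideal_def by (intro exI[of _ "{P. prime_ideal K P \<and> x \<in> P}"]) simp
  then show "semiprime_closure K x \<subseteq> ob K \<inter> \<Inter>{P. prime_ideal K P \<and> x \<in> P}"
    using assms unfolding semiprime_closure_def by (intro Inter_lower) simp
  show "ob K \<inter> \<Inter>{P. prime_ideal K P \<and> x \<in> P} \<subseteq> semiprime_closure K x"
    unfolding semiprime_closure_def
  proof (rule Inter_greatest)
    fix J assume "J \<in> {J. semiprime_ideal K J \<and> x \<in> J}"
    then obtain \<P> where "\<forall>P \<in> \<P>. prime_ideal K P" "J = ob K \<inter> \<Inter>\<P>" "x \<in> J"
      by (auto simp: semiprime_ideal_def)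
    then show "ob K \<inter> \<Inter>{P. prime_ideal K P \<and> x \<in> P} \<subseteq> J"
      by auto
  qed
qed

text \<open>The primes containing \<open>x \<odot> y\<close> form the union of the families for
  \<open>x\<close> and for \<open>y\<close>, and intersecting over a union of families intersects
  the two closures.\<close>

lemma semiprime_closure_central:
  assumes "x \<in> ob K" "y \<in> ob K" "I \<subseteq> ob K" "thick_generated K I = ob K" "centralizes K x I"
  shows "semiprime_closure K x \<inter> semiprime_closure K y = semiprime_closure K (x \<odot> y)"
proof -
  have "x \<odot> y \<in> P \<longleftrightarrow> x \<in> P \<or> y \<in> P" if P: "prime_ideal K P" for P
    using prime_ideal_central[OF P assms] P assms(1,2) by (auto simp: prime_ideal_def thick_ideal_def)
  then show ?thesis
    using assms(1,2) tensor_ob by (auto simp: semiprime_closure_eq)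
qed

text \<open>Replacing \<open>x\<close> by a centralizing generator \<open>z\<close> of the same
  ideal leaves its semiprime closure unchanged; the witness is then
  \<open>z \<odot> y\<close>.\<close>

lemma weak_central_generation_principally_closed:
  assumes "weak_central_generation K I"
  shows "principally_closed K"
  unfolding principally_closed_def
proof (intro ballI)
  fix x y assume x: "x \<in> ob K" and y: "y \<in> ob K"
  obtain z where z: "z \<in> ob K" "centralizes K z I" "ideal_generated K {z} = ideal_generated K {x}"
    using central_generator[OF assms x] .
  have "semiprime_closure K x \<inter> semiprime_closure K y = semiprime_closure K (z \<odot> y)"
    using semiprime_closure_central[OF z(1) y _ _ z(2)] semiprime_closure_cong[OF z(3)] assms
    by (simp add: weak_central_generation_def)
  then show "\<exists>z \<in> ob K. semiprime_closure K x \<inter> semiprime_closure K y = semiprime_closure K z"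
    using tensor_ob[OF z(1) y] by blast
qed


section \<open>Duals yield retracts and hence compact detection\<close>

section \<open>Rigidity\<close>

text \<open>The first zigzag identity says that a composite through
  \<open>(x \<odot> d) \<odot> x\<close> is the left unitor; composing with the inverse
  \<open>l\<close> of the unitor turns it into a retraction identity.\<close>

lemma dual_pair_retract:
  assumes "dual_pair K d x"
  obtains i r where "i \<in> Hom K x ((x \<odot> d) \<odot> x)" "r \<in> Hom K ((x \<odot> d) \<odot> x) x" "r \<cdot> i = idn K x"
proof -
  obtain ev coev where d: "d \<in> ob K" and x: "x \<in> ob K"
    and ev: "ev \<in> Hom K (d \<odot> x) (unit_ob K)" and coev: "coev \<in> Hom K (unit_ob K) (x \<odot> d)"
    and zigzag: "runitor K x \<cdot> (idn K x \<star> ev) \<cdot> associator K x d x \<cdot> (coev \<star> idn K x) = lunitor K x"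
    using assms unfolding dual_pair_def by blast
  let ?r = "runitor K x \<cdot> (idn K x \<star> ev) \<cdot> associator K x d x"
  obtain l where l: "l \<in> Hom K x (unit_ob K \<odot> x)" "lunitor K x \<cdot> l = idn K x"
    using lunitor_Hom[OF x] lunitor_iso[OF x] by (auto simp: iso_arr_def inverse_arrs_def Hom_def)
  have c: "coev \<star> idn K x \<in> Hom K (unit_ob K \<odot> x) ((x \<odot> d) \<odot> x)"
    using tensor_arr[OF coev idn_Hom[OF x]] .
  have r: "?r \<in> Hom K ((x \<odot> d) \<odot> x) x"
    using cmp_Hom[OF associator_Hom[OF x d x]
        cmp_Hom[OF tensor_arr[OF idn_Hom[OF x] ev] runitor_Hom[OF x]]] .
  have "?r \<cdot> ((coev \<star> idn K x) \<cdot> l) = idn K x"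
    using cmp_assoc[OF l(1) c r] zigzag l(2) by simp
  then show thesis
    using that[OF cmp_Hom[OF l(1) c] r] by blast
qed

lemma rigid_compact_detection:
  assumes "rigid K"
  shows "compact_detection K"
  unfolding compact_detection_def
proof
  fix x assume x: "x \<in> ob K"
  obtain d where dual: "dual_pair K d x"
    using assms x by (auto simp: rigid_def)
  then have d: "d \<in> ob K"
    by (simp add: dual_pair_def)
  have "x \<in> J \<longleftrightarrow> (x \<odot> d) \<odot> x \<in> J" if "semiprime_ideal K J" for J
  proof -
    have J: "thick_ideal K J"
      using semiprime_thick_ideal[OF that] .
    obtain i r where "i \<in> Hom K x ((x \<odot> d) \<odot> x)" "r \<in> Hom K ((x \<odot> d) \<odot> x) x" "r \<cdot> i = idn K x"
      using dual_pair_retract[OF dual] .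
    then have "x \<in> J" if "(x \<odot> d) \<odot> x \<in> J"
      using that by (rule thick_retract[OF thick_ideal_thick[OF J]])
    moreover have "(x \<odot> d) \<odot> x \<in> J" if "x \<in> J"
      using J that tensor_ob[OF x d] by (simp add: thick_ideal_def)
    ultimately show ?thesis
      by blast
  qed
  then show "\<exists>s \<in> ob K. \<forall>J. semiprime_ideal K J \<longrightarrow> (x \<in> J \<longleftrightarrow> (x \<odot> s) \<odot> x \<in> J)"
    using d by blast
qed

end

theorem proposition7p3:
  fixes K :: "('o, 'm, 'z) mt_cat_scheme" and I :: "'o set"
  assumes "monoidal_triangulated_category K"
    and "weak_central_generation K I"
  shows "(rigid K \<longrightarrow> compact_detection K) \<and>
    (compact_detection K \<longrightarrow>
       (\<forall>J. principal_ideal K J \<longrightarrow>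
          (\<exists>z \<in> ob K. centralizes K z I \<and> J = ideal_generated K {z})) \<and>
       principally_closed K)"
proof -
  interpret monoidal_triangulated_category K by fact
  have "\<exists>z \<in> ob K. centralizes K z I \<and> J = ideal_generated K {z}" if J: "principal_ideal K J" for J
  proof -
    obtain x where x: "x \<in> ob K" "J = ideal_generated K {x}"
      using J by (auto simp: principal_ideal_def)
    show ?thesis
      using central_generator[OF assms(2) x(1)] x(2) by metis
  qed
  then show ?thesis
    using rigid_compact_detection weak_central_generation_principally_closed[OF assms(2)] by blast
qed

end
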